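(* Let $\ell>0$ and let $V:(0,1)\to\mathbb{C}$ be measurable with $\int_0^1 r|V(r)|\,dr<\infty$. Define, for $r\in(0,1]$, $$\psi_0^\ell(r)=r^{\ell+1},\qquad \psi_k^\ell(r)=\int_0^r \mathcal{L}_\ell(r,s)V(s)\psi_{k-1}^\ell(s)\,ds\quad(k\ge1),\qquad w_\ell(r)=\sum_{k=0}^\infty\psi_k^\ell(r),$$ where $\mathcal{L}_\ell(r,s)=\frac{1}{2\ell+1}\left(\frac{r^{\ell+1}}{s^\ell}-\frac{s^{\ell+1}}{r^\ell}\right)$. Then the series $\sum_k\psi_k^\ell$ and the series of first derivatives $\sum_k(\psi_k^\ell)'$ converge absolutely and uniformly on $[0,1]$. In particular $w_\ell\in C^1[0,1]$. Furthermore, $w_\ell'\in AC[\delta,1]$ for all $0<\delta<1$. The function $w_\ell$ satisfies the perturbed Bessel equation $$-w_\ell''+\frac{\ell(\ell+1)}{r^2}w_\ell+V(r)w_\ell=0$$ a.e. on $(0,1)$, and the asymptotic conditions $$w_\ell(r)\sim r^{\ell+1},\qquad w_\ell'(r)\sim(\ell+1)r^\ell,\qquad r\to0^+.$$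
   Context: $AC[\delta,1]$ denotes the absolutely continuous functions on $[\delta,1]$. The functions $\psi_k^\ell$ are extended to $r=0$ by their limits as $r\to0^+$. $g(r)\sim h(r)$ as $r\to0^+$ means $g(r)/h(r)\to1$. *)

theory Defs
  imports "HOL-Analysis.Analysis" "HOL-Library.Landau_Symbols"
begin

definition bessel_kernel :: "real \<Rightarrow> real \<Rightarrow> real \<Rightarrow> real" where
  "bessel_kernel l r s =
     1 / (2 * l + 1) * (r powr (l + 1) / s powr l - s powr (l + 1) / r powr l)"

text \<open>The iterates on the half-open interval; only arguments \<open>0 < r \<le> 1\<close> are meaningful. The
  integral uses the values of \<open>V\<close> on \<open>(0,1)\<close> only, where \<open>V\<close> is defined.\<close>

primrec bessel_iter_pos :: "real \<Rightarrow> (real \<Rightarrow> complex) \<Rightarrow> nat \<Rightarrow> real \<Rightarrow> complex" where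
  "bessel_iter_pos l V 0 = (\<lambda>r. of_real (r powr (l + 1)))"
| "bessel_iter_pos l V (Suc k) = (\<lambda>r.
     LINT s:{0<..<r}|lebesgue. of_real (bessel_kernel l r s) * V s * bessel_iter_pos l V k s)"

definition bessel_iter :: "real \<Rightarrow> (real \<Rightarrow> complex) \<Rightarrow> nat \<Rightarrow> real \<Rightarrow> complex" where
  "bessel_iter l V k r =
     (if r = 0 then Lim (at_right 0) (bessel_iter_pos l V k) else bessel_iter_pos l V k r)"

definition bessel_sol :: "real \<Rightarrow> (real \<Rightarrow> complex) \<Rightarrow> real \<Rightarrow> complex" where
  "bessel_sol l V r = (\<Sum>k. bessel_iter l V k r)"

text \<open>The derivative of a function on \<open>[0,1]\<close>, one-sided at the endpoints. As
  \<^const>\<open>vector_derivative\<close> is total, differentiability has to be stated separately.\<close>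

definition deriv01 :: "(real \<Rightarrow> complex) \<Rightarrow> real \<Rightarrow> complex" where
  "deriv01 f r = vector_derivative f (at r within {0..1})"

definition series_abs_unif_convergent_on :: "real set \<Rightarrow> (nat \<Rightarrow> real \<Rightarrow> complex) \<Rightarrow> bool" where
  "series_abs_unif_convergent_on S f \<longleftrightarrow>
     (\<forall>x\<in>S. summable (\<lambda>k. norm (f k x))) \<and>
     uniformly_convergent_on S (\<lambda>n x. \<Sum>k<n. f k x)"

text \<open>Unlike the library's \<open>C1_differentiable_on\<close>, this uses one-sided derivatives at the
  endpoints, so that values of \<open>f\<close> outside \<open>[a,b]\<close> are irrelevant.\<close>

definition C1_on_interval :: "real \<Rightarrow> real \<Rightarrow> (real \<Rightarrow> complex) \<Rightarrow> bool" where
  "C1_on_interval a b f \<longleftrightarrow>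
     (\<exists>f'. (\<forall>x\<in>{a..b}. (f has_vector_derivative f' x) (at x within {a..b})) \<and>
           continuous_on {a..b} f')"

definition AC_on_interval :: "real \<Rightarrow> real \<Rightarrow> (real \<Rightarrow> complex) \<Rightarrow> bool" where
  "AC_on_interval a b f \<longleftrightarrow>
     (\<forall>\<epsilon>>0. \<exists>\<eta>>0. \<forall>n (u :: nat \<Rightarrow> real) v.
        (\<forall>i<n. a \<le> u i \<and> u i \<le> v i \<and> v i \<le> b) \<and>
        disjoint_family_on (\<lambda>i. {u i<..<v i}) {..<n} \<and>
        (\<Sum>i<n. v i - u i) < \<eta> \<longrightarrow>
        (\<Sum>i<n. norm (f (v i) - f (u i))) < \<epsilon>)"

end

theory Submission
  imports Defs
begin

text \<open>The iterates satisfy \<open>\<psi>\<^sub>k\<^sub>+\<^sub>1 = G \<psi>\<^sub>k\<close>, where \<open>G f (r)\<close> is the integral of \<open>L(r,s) V(s) f(s)\<close> over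
\<open>(0,r)\<close>. The kernel splits into products of the free solutions \<open>r\<^sup>l\<^sup>+\<^sup>1\<close> and \<open>r\<^sup>-\<^sup>l\<close>, so that
\[ (2l+1)\, G f(r) = r^{l+1} A(r) - r^{-l} B(r), \quad
   A(r) = \int_0^r s^{-l} V f, \quad B(r) = \int_0^r s^{l+1} V f . \]
This is variation of parameters: although \<open>A\<close> and \<open>B\<close> are differentiable only almost everywhere,
the terms that contain their derivatives cancel, and \<open>G f\<close> is differentiable at \<^emph>\<open>every\<close> point of
\<open>(0,1]\<close>, with \<open>(2l+1) (G f)' = (l+1) r\<^sup>l A + l r\<^sup>-\<^sup>l\<^sup>-\<^sup>1 B\<close>
(lemma \<open>variation_of_parameters_derivative\<close>).

If \<open>|f(s)| \<le> s\<^sup>l\<^sup>+\<^sup>1 h(s)\<close>, both \<open>G f\<close> and its derivative are controlled by the integral of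
\<open>\<rho> h\<close>, where \<open>\<rho>(s) = 2 s |V(s)|\<close> is integrable: \<open>|G f(r)| \<le> r\<^sup>l\<^sup>+\<^sup>1 T(r)\<close> and
\<open>|(G f)'(r)| \<le> r\<^sup>l T(r)\<close> with \<open>T(r)\<close> the integral of \<open>\<rho> h\<close> over \<open>(0,r)\<close> (lemma \<open>norm_green_le\<close>).
Iterating, \<open>|\<psi>\<^sub>k(r)| \<le> r\<^sup>l\<^sup>+\<^sup>1 N\<^sub>k(r)\<close> with \<open>N\<^sub>0 = 1\<close> and \<open>N\<^sub>k\<^sub>+\<^sub>1(r)\<close> the integral of \<open>\<rho> N\<^sub>k\<close> over
\<open>(0,r)\<close>. A Gronwall argument bounds the partial sums of \<open>\<Sum>\<^sub>k N\<^sub>k(1)\<close>: over an interval on which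
\<open>\<rho>\<close> has mass at most \<open>1/2\<close> these sums at most double, and finitely many such intervals cover
\<open>[0,1]\<close> (lemma \<open>volterra_majorant_summable\<close>). The Weierstrass test then gives both uniform
convergence claims.

Passing to the limit gives \<open>w = r\<^sup>l\<^sup>+\<^sup>1 + G w\<close>, and everything else is read off from this equation.
Since \<open>T(r) \<rightarrow> 0\<close> as \<open>r \<rightarrow> 0\<close>, the two bounds on \<open>G w\<close> are exactly the asymptotic conditions and
also give continuity of \<open>w'\<close> at \<open>0\<close>. On \<open>[\<delta>,1]\<close> the derivative \<open>w'\<close> is a combination of the
absolutely continuous functions \<open>A\<close> and \<open>B\<close> with smooth coefficients; by Lebesgue's
differentiation theorem it can be differentiated almost everywhere, which yields the equation.\<close>

section \<open>Summable majorants for Volterra iterations\<close>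

lemma integral_Icc_diff:
  fixes f :: "real \<Rightarrow> 'a::banach"
  assumes "f integrable_on {a..b}" "a \<le> x" "x \<le> y" "y \<le> b"
  shows "integral {a..y} f - integral {a..x} f = integral {x..y} f"
proof -
  have "f integrable_on {a..y}"
    using assms by (auto intro: integrable_on_subinterval)
  then show ?thesis
    using Henstock_Kurzweil_Integration.integral_combine[of a x y f] assms by (simp add: algebra_simps)
qed

text \<open>These functions dominate the Picard iterates of a Volterra equation whose kernel is bounded by \<open>\<rho>\<close>.
Explicitly the \<open>k\<close>-th one is \<open>M(r)\<^sup>k / k!\<close> with \<open>M\<close> the primitive of \<open>\<rho>\<close>; the recursive form is
all that the estimates use, and it avoids differentiating powers of the merely absolutely
continuous function \<open>M\<close>.\<close>

primrec volterra_majorant :: "(real \<Rightarrow> real) \<Rightarrow> nat \<Rightarrow> real \<Rightarrow> real" where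
  "volterra_majorant \<rho> 0 = (\<lambda>r. 1)"
| "volterra_majorant \<rho> (Suc k) = (\<lambda>r. integral {0..r} (\<lambda>s. \<rho> s * volterra_majorant \<rho> k s))"

lemma absolutely_integrable_mult_continuous:
  fixes \<rho> g :: "real \<Rightarrow> real"
  assumes "\<rho> absolutely_integrable_on {a..b}" "continuous_on {a..b} g"
  shows "(\<lambda>s. \<rho> s * g s) absolutely_integrable_on {a..b}"
proof -
  have "(\<lambda>s. g s * \<rho> s) absolutely_integrable_on {a..b}"
  proof (rule absolutely_integrable_bounded_measurable_product_real)
    show "g \<in> borel_measurable (lebesgue_on {a..b})"
      using assms(2) by (intro continuous_imp_measurable_on_sets_lebesgue) auto
    show "bounded (g ` {a..b})"
      using assms(2) by (intro compact_imp_bounded compact_continuous_image) auto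
  qed (use assms in auto)
  then show ?thesis by (simp add: mult.commute)
qed

context
  fixes \<rho> :: "real \<Rightarrow> real"
  assumes ai: "\<rho> absolutely_integrable_on {0..1}"
    and nonneg: "\<And>s. s \<in> {0..1} \<Longrightarrow> 0 \<le> \<rho> s"
begin

lemma volterra_majorant_continuous: "continuous_on {0..1} (volterra_majorant \<rho> k)"
proof (induction k)
  case (Suc k)
  have "(\<lambda>s. \<rho> s * volterra_majorant \<rho> k s) integrable_on {0..1}"
    using absolutely_integrable_mult_continuous[OF ai Suc] set_lebesgue_integral_eq_integral(1) by blast
  then show ?case by (simp add: indefinite_integral_continuous_1)
qed auto

lemma volterra_majorant_integrable:
  assumes "0 \<le> a" "b \<le> 1"
  shows "(\<lambda>s. \<rho> s * volterra_majorant \<rho> k s) integrable_on {a..b}"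
proof -
  have "(\<lambda>s. \<rho> s * volterra_majorant \<rho> k s) integrable_on {0..1}"
    using absolutely_integrable_mult_continuous[OF ai volterra_majorant_continuous]
      set_lebesgue_integral_eq_integral(1) by blast
  then show ?thesis
    using assms by (auto intro: integrable_on_subinterval)
qed

lemma volterra_majorant_nonneg: "r \<in> {0..1} \<Longrightarrow> 0 \<le> volterra_majorant \<rho> k r"
proof (induction k arbitrary: r)
  case (Suc k)
  have "0 \<le> integral {0..r} (\<lambda>s. \<rho> s * volterra_majorant \<rho> k s)"
    using Suc nonneg
    by (intro Henstock_Kurzweil_Integration.integral_nonneg volterra_majorant_integrable) auto
  then show ?case by simp
qed auto

lemma volterra_majorant_mono:
  assumes "0 \<le> x" "x \<le> y" "y \<le> 1"
  shows "volterra_majorant \<rho> k x \<le> volterra_majorant \<rho> k y"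
proof (cases k)
  case (Suc j)
  have "0 \<le> integral {x..y} (\<lambda>s. \<rho> s * volterra_majorant \<rho> j s)"
    using assms nonneg volterra_majorant_nonneg
    by (intro Henstock_Kurzweil_Integration.integral_nonneg volterra_majorant_integrable) auto
  then show ?thesis
    using integral_Icc_diff[OF volterra_majorant_integrable[of 0 1 j], of x y] assms Suc by simp
qed auto

text \<open>One step of the Gronwall argument. The partial sums satisfy \<open>S(y) \<le> S(x) + q S(y)\<close>, where \<open>q\<close> is
the mass of \<open>\<rho>\<close> on \<open>[x,y]\<close>, since the majorants increase; for \<open>q \<le> 1/2\<close> the last term can be
absorbed on the left.\<close>

lemma volterra_majorant_step:
  assumes "0 \<le> x" "x \<le> y" "y \<le> 1" and half: "integral {x..y} \<rho> \<le> 1 / 2"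
  shows "(\<Sum>k<n. volterra_majorant \<rho> k y) \<le> 2 * (\<Sum>k<n. volterra_majorant \<rho> k x)"
proof -
  let ?N = "volterra_majorant \<rho>"
  have step: "?N (Suc j) y \<le> ?N (Suc j) x + 1/2 * ?N j y" for j
  proof -
    have rint: "\<rho> integrable_on {x..y}"
      using volterra_majorant_integrable[of x y 0] assms by simp
    have "integral {x..y} (\<lambda>s. \<rho> s * ?N j s) \<le> integral {x..y} (\<lambda>s. \<rho> s * ?N j y)"
      using assms rint
      by (intro integral_le volterra_majorant_integrable integrable_on_mult_left)
         (auto intro!: mult_left_mono nonneg volterra_majorant_mono)
    also have "\<dots> = integral {x..y} \<rho> * ?N j y" by simp
    also have "\<dots> \<le> 1/2 * ?N j y"
      using assms by (intro mult_right_mono half volterra_majorant_nonneg) auto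
    finally show ?thesis
      using integral_Icc_diff[OF volterra_majorant_integrable[of 0 1 j], of x y] assms by simp
  qed
  have nn: "0 \<le> ?N k y" for k using assms by (intro volterra_majorant_nonneg) auto
  show ?thesis
  proof (cases n)
    case (Suc m)
    have "(\<Sum>k<Suc m. ?N k y) = 1 + (\<Sum>k<m. ?N (Suc k) y)"
      by (subst sum.lessThan_Suc_shift) simp
    also have "\<dots> \<le> 1 + (\<Sum>k<m. ?N (Suc k) x + 1/2 * ?N k y)"
      using step by (intro add_mono sum_mono) auto
    also have "\<dots> = (\<Sum>k<Suc m. ?N k x) + 1/2 * (\<Sum>k<m. ?N k y)"
      by (subst sum.lessThan_Suc_shift) (simp add: sum.distrib sum_distrib_left)
    finally have "(\<Sum>k<Suc m. ?N k y) \<le> (\<Sum>k<Suc m. ?N k x) + 1/2 * (\<Sum>k<m. ?N k y)" .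
    moreover have "(\<Sum>k<m. ?N k y) \<le> (\<Sum>k<Suc m. ?N k y)"
      using nn[of m] by simp
    ultimately show ?thesis unfolding Suc by linarith
  qed simp
qed

text \<open>Uniform continuity of the primitive of \<open>\<rho>\<close> gives a mesh \<open>1/m\<close> on whose cells the previous lemma
applies, so that all partial sums are at most \<open>2\<^sup>m\<close> at the right endpoint.\<close>

lemma volterra_majorant_summable: "summable (\<lambda>k. volterra_majorant \<rho> k 1)"
proof -
  let ?N = "volterra_majorant \<rho>"
  have rint: "\<rho> integrable_on {0..1}"
    using ai set_lebesgue_integral_eq_integral(1) by blast
  have uc: "uniformly_continuous_on {0..1} (\<lambda>x. integral {0..x} \<rho>)"
    using rint by (intro compact_uniformly_continuous indefinite_integral_continuous_1) auto
  have "\<exists>d>0. \<forall>x\<in>{0..1}. \<forall>y\<in>{0..1}. dist y x < d \<longrightarrow>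
          dist (integral {0..y} \<rho>) (integral {0..x} \<rho>) < 1/2"
    by (rule uc[unfolded uniformly_continuous_on_def, THEN spec, THEN mp]) simp
  then obtain d where "d > 0" and
    d: "\<And>x y. x \<in> {0..1} \<Longrightarrow> y \<in> {0..1} \<Longrightarrow> dist y x < d \<Longrightarrow>
          dist (integral {0..y} \<rho>) (integral {0..x} \<rho>) < 1/2"
    by auto
  obtain m :: nat where m: "1 / d < real m"
    using reals_Archimedean2 by blast
  moreover have "1 / d > 0" using \<open>d > 0\<close> by simp
  ultimately have "m > 0" using of_nat_0_less_iff[where 'a=real] by (metis less_trans)
  have *: "(\<Sum>k<n. ?N k (real j / real m)) \<le> 2 ^ j" if "j \<le> m" for j n
    using that
  proof (induction j)
    case 0
    have "(\<Sum>k<n. ?N k 0) \<le> 1"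
    proof -
      have "?N k 0 = (if k = 0 then 1 else 0)" for k by (cases k) auto
      then show ?thesis by (simp add: sum.If_cases)
    qed
    then show ?case by simp
  next
    case (Suc j)
    let ?x = "real j / real m" and ?y = "real (Suc j) / real m"
    have xy: "0 \<le> ?x" "?x \<le> ?y" "?y \<le> 1"
      using Suc.prems \<open>m > 0\<close> by (auto simp: divide_simps)
    have "?y - ?x = 1 / real m" by (simp add: diff_divide_distrib[symmetric])
    also have "\<dots> < d" using m \<open>m > 0\<close> \<open>d > 0\<close> by (simp add: field_simps)
    finally have "dist ?y ?x < d" using xy by (simp add: dist_real_def)
    then have "integral {0..?y} \<rho> - integral {0..?x} \<rho> \<le> 1/2"
      using d[OF _ _ \<open>dist ?y ?x < d\<close>] xy by (smt (verit) atLeastAtMost_iff dist_real_def)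
    then have "integral {?x..?y} \<rho> \<le> 1/2"
      using integral_Icc_diff[OF rint xy] by simp
    then have "(\<Sum>k<n. ?N k ?y) \<le> 2 * (\<Sum>k<n. ?N k ?x)"
      by (intro volterra_majorant_step xy)
    then show ?case using Suc by simp
  qed
  show ?thesis
  proof (rule summableI_nonneg_bounded)
    show "(\<Sum>k<n. ?N k 1) \<le> 2 ^ m" for n using *[of m n] \<open>m > 0\<close> by simp
  qed (rule volterra_majorant_nonneg, simp)
qed

end

section \<open>Absolutely continuous functions and Lebesgue differentiation\<close>

text \<open>Truncate \<open>|g|\<close> at height \<open>n\<close>. The excess \<open>|g| - min |g| n\<close> has small integral for large \<open>n\<close>, by
dominated convergence, whereas the truncated part contributes at most \<open>n\<close> times the total length
of the intervals.\<close>

lemma AC_on_interval_integral: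
  fixes g :: "real \<Rightarrow> complex"
  assumes g: "g absolutely_integrable_on {a..b}"
  shows "AC_on_interval a b (\<lambda>r. integral {a..r} g)"
  unfolding AC_on_interval_def
proof (intro allI impI)
  fix \<epsilon> :: real assume "\<epsilon> > 0"
  have gn: "(\<lambda>x. norm (g x)) absolutely_integrable_on {a..b}"
    using absolutely_integrable_norm[OF g] by (simp add: o_def)
  define t where "t = (\<lambda>(n::nat) x. norm (g x) - min (norm (g x)) (real n))"
  have cai: "(\<lambda>x. real n) absolutely_integrable_on {a..b}" for n :: nat
    by (rule absolutely_integrable_continuous_real) simp
  have mi: "(\<lambda>x. min (norm (g x)) (real n)) absolutely_integrable_on {a..b}" for n :: nat
    by (rule absolutely_integrable_min_1[OF gn cai])
  have tint: "t n integrable_on {a..b}" for n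
    unfolding t_def using gn mi
    by (intro integrable_diff set_lebesgue_integral_eq_integral(1))
  have "(\<lambda>n. integral {a..b} (t n)) \<longlonglongrightarrow> integral {a..b} (\<lambda>x. 0)"
  proof (rule dominated_convergence)
    show "(\<lambda>x. norm (g x)) integrable_on {a..b}"
      using gn set_lebesgue_integral_eq_integral(1) by blast
    show "(\<lambda>n. t n x) \<longlonglongrightarrow> 0" for x
    proof (rule tendsto_eventually)
      obtain k :: nat where "norm (g x) \<le> real k" using real_arch_simple by blast
      then show "\<forall>\<^sub>F n in sequentially. t n x = 0"
        by (auto simp: t_def eventually_sequentially min_def intro!: exI[of _ k])
    qed
    show "t n integrable_on {a..b}" for n by (rule tint)
  qed (auto simp: t_def)
  then have "\<forall>\<^sub>F n in sequentially. integral {a..b} (t n) < \<epsilon>/2"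
    using \<open>\<epsilon> > 0\<close> by (intro order_tendstoD(2)) auto
  then obtain n where n: "integral {a..b} (t n) < \<epsilon>/2"
    using eventually_happens'[OF sequentially_bot] by blast
  \<comment> \<open>The denominator \<open>n + 1\<close> also covers the height \<open>n = 0\<close>.\<close>
  define \<eta> where "\<eta> = \<epsilon> / (2 * (real n + 1))"
  have "\<eta> > 0" using \<open>\<epsilon> > 0\<close> by (simp add: \<eta>_def)
  show "\<exists>\<eta>>0. \<forall>(n::nat) u v. (\<forall>i<n. a \<le> u i \<and> u i \<le> v i \<and> v i \<le> b) \<and>
        disjoint_family_on (\<lambda>i. {u i<..<v i}) {..<n} \<and>
        (\<Sum>i<n. v i - u i) < \<eta> \<longrightarrow>
        (\<Sum>i<n. norm (integral {a..v i} g - integral {a..u i} g)) < \<epsilon>"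
  proof (intro exI[of _ \<eta>] conjI allI impI \<open>\<eta> > 0\<close>)
    fix m and u v :: "nat \<Rightarrow> real"
    assume A: "(\<forall>i<m. a \<le> u i \<and> u i \<le> v i \<and> v i \<le> b) \<and>
        disjoint_family_on (\<lambda>i. {u i<..<v i}) {..<m} \<and> (\<Sum>i<m. v i - u i) < \<eta>"
    have sub: "f integrable_on {u i..v i}" if "i < m" "f integrable_on {a..b}" for i and f :: "real \<Rightarrow> real"
      using that(2) by (rule integrable_on_subinterval) (use that(1) A in auto)
    have gi: "g integrable_on {a..b}" using g set_lebesgue_integral_eq_integral(1) by blast
    have each: "norm (integral {a..v i} g - integral {a..u i} g)
        \<le> integral {u i..v i} (t n) + real n * (v i - u i)" if "i < m" for i
    proof -
      have i: "a \<le> u i" "u i \<le> v i" "v i \<le> b" using A that by auto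
      have "norm (integral {u i..v i} g) \<le> integral {u i..v i} (\<lambda>x. t n x + real n)"
      proof (rule Henstock_Kurzweil_Integration.integral_norm_bound_integral)
        show "g integrable_on {u i..v i}" using gi i by (auto intro: integrable_on_subinterval)
        show "(\<lambda>x. t n x + real n) integrable_on {u i..v i}"
          by (intro integrable_add sub that tint) auto
      qed (auto simp: t_def)
      also have "\<dots> = integral {u i..v i} (t n) + real n * (v i - u i)"
        using i by (subst Henstock_Kurzweil_Integration.integral_add) (auto intro: sub that tint)
      finally show ?thesis using integral_Icc_diff[OF gi i] by simp
    qed
    have "(\<Sum>i<m. integral {u i..v i} (t n)) \<le> integral {a..b} (t n)"
    proof -
      have "(t n has_integral (\<Sum>i<m. integral {u i..v i} (t n))) (\<Union>i<m. {u i<..<v i})"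
      proof (rule has_integral_UN)
        show "(t n has_integral integral {u i..v i} (t n)) {u i<..<v i}" if "i \<in> {..<m}" for i
          using sub[of i "t n"] that tint
          by (simp add: has_integral_Icc_iff_Ioo[symmetric] integrable_integral)
        show "pairwise (\<lambda>i i'. negligible ({u i<..<v i} \<inter> {u i'<..<v i'})) {..<m}"
          using A by (auto simp: pairwise_def disjoint_family_on_def)
      qed auto
      then show ?thesis
      proof (rule has_integral_subset_le[rotated 1])
        show "(t n has_integral integral {a..b} (t n)) {a..b}"
          using tint by (rule integrable_integral)
        show "(\<Union>i<m. {u i<..<v i}) \<subseteq> {a..b}" using A by fastforce
      qed (auto simp: t_def)
    qed
    moreover have "real n * (\<Sum>i<m. v i - u i) \<le> \<epsilon> / 2"
    proof -
      have "real n * (\<Sum>i<m. v i - u i) \<le> real n * \<eta>"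
        using A by (intro mult_left_mono) auto
      also have "\<dots> \<le> (real n + 1) * \<eta>" using \<open>\<eta> > 0\<close> by simp
      also have "\<dots> = \<epsilon> / 2" by (simp add: \<eta>_def field_simps)
      finally show ?thesis .
    qed
    moreover have "(\<Sum>i<m. norm (integral {a..v i} g - integral {a..u i} g))
        \<le> (\<Sum>i<m. integral {u i..v i} (t n) + real n * (v i - u i))"
      using each by (intro sum_mono) auto
    ultimately show "(\<Sum>i<m. norm (integral {a..v i} g - integral {a..u i} g)) < \<epsilon>"
      using n by (simp add: sum.distrib sum_distrib_left)
  qed
qed

text \<open>A comparison principle: absolute continuity only concerns the sizes of increments, so it passes to
any function whose increments are controlled by those of absolutely continuous functions and of
the identity. Closure under sums and under smooth multipliers are special cases.\<close>

lemma AC_on_interval_dominated: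
  fixes F G h :: "real \<Rightarrow> complex"
  assumes F: "AC_on_interval a b F" and G: "AC_on_interval a b G" and "K \<ge> 0"
    and le: "\<And>x y. a \<le> x \<Longrightarrow> x \<le> y \<Longrightarrow> y \<le> b \<Longrightarrow>
           norm (h y - h x) \<le> K * (norm (F y - F x) + norm (G y - G x) + (y - x))"
  shows "AC_on_interval a b h"
  unfolding AC_on_interval_def
proof (intro allI impI)
  fix \<epsilon> :: real assume "\<epsilon> > 0"
  define e where "e = \<epsilon> / (3 * (K + 1))"
  have e: "e > 0" "3 * (K + 1) * e = \<epsilon>" using \<open>\<epsilon> > 0\<close> \<open>K \<ge> 0\<close> by (auto simp: e_def)
  from F[unfolded AC_on_interval_def, THEN spec, THEN mp, OF e(1)]
  obtain d1 where d1: "d1 > 0 \<and> (\<forall>(n::nat) u v. (\<forall>i<n. a \<le> u i \<and> u i \<le> v i \<and> v i \<le> b) \<and>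
        disjoint_family_on (\<lambda>i. {u i<..<v i}) {..<n} \<and>
        (\<Sum>i<n. v i - u i) < d1 \<longrightarrow> (\<Sum>i<n. norm (F (v i) - F (u i))) < e)"
    ..
  from G[unfolded AC_on_interval_def, THEN spec, THEN mp, OF e(1)]
  obtain d2 where d2: "d2 > 0 \<and> (\<forall>(n::nat) u v. (\<forall>i<n. a \<le> u i \<and> u i \<le> v i \<and> v i \<le> b) \<and>
        disjoint_family_on (\<lambda>i. {u i<..<v i}) {..<n} \<and>
        (\<Sum>i<n. v i - u i) < d2 \<longrightarrow> (\<Sum>i<n. norm (G (v i) - G (u i))) < e)"
    ..
  show "\<exists>\<eta>>0. \<forall>(n::nat) u v. (\<forall>i<n. a \<le> u i \<and> u i \<le> v i \<and> v i \<le> b) \<and>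
        disjoint_family_on (\<lambda>i. {u i<..<v i}) {..<n} \<and>
        (\<Sum>i<n. v i - u i) < \<eta> \<longrightarrow> (\<Sum>i<n. norm (h (v i) - h (u i))) < \<epsilon>"
  proof (intro exI[of _ "min e (min d1 d2)"] conjI allI impI)
    fix n and u v :: "nat \<Rightarrow> real"
    assume A: "(\<forall>i<n. a \<le> u i \<and> u i \<le> v i \<and> v i \<le> b) \<and>
        disjoint_family_on (\<lambda>i. {u i<..<v i}) {..<n} \<and> (\<Sum>i<n. v i - u i) < min e (min d1 d2)"
    let ?S = "(\<Sum>i<n. norm (F (v i) - F (u i))) + (\<Sum>i<n. norm (G (v i) - G (u i))) + (\<Sum>i<n. v i - u i)"
    have "(\<Sum>i<n. norm (F (v i) - F (u i))) < e" "(\<Sum>i<n. norm (G (v i) - G (u i))) < e"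
      by (rule d1[THEN conjunct2, rule_format], use A in auto)
         (rule d2[THEN conjunct2, rule_format], use A in auto)
    then have S: "?S < 3 * e" using A by linarith
    have "(\<Sum>i<n. norm (h (v i) - h (u i)))
        \<le> (\<Sum>i<n. K * (norm (F (v i) - F (u i)) + norm (G (v i) - G (u i)) + (v i - u i)))"
      using A le by (intro sum_mono) auto
    also have "\<dots> = K * ?S" by (simp add: sum.distrib sum_distrib_left[symmetric])
    also have "\<dots> \<le> K * (3 * e)" using S \<open>K \<ge> 0\<close> by (intro mult_left_mono) auto
    also have "\<dots> < \<epsilon>" using e by (simp add: algebra_simps)
    finally show "(\<Sum>i<n. norm (h (v i) - h (u i))) < \<epsilon>" .
  next
    show "min e (min d1 d2) > 0" using e(1) d1 d2 by (simp add: conjunct1)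
  qed
qed

lemma AC_on_interval_const: "AC_on_interval a b (\<lambda>r. c)"
  unfolding AC_on_interval_def by (auto intro: exI[of _ 1])

lemma AC_on_interval_add:
  assumes "AC_on_interval a b F" "AC_on_interval a b G"
  shows "AC_on_interval a b (\<lambda>r. F r + G r)"
proof (rule AC_on_interval_dominated[OF assms, of 1])
  fix x y :: real assume "x \<le> y"
  have "F y + G y - (F x + G x) = (F y - F x) + (G y - G x)" by simp
  then have "norm (F y + G y - (F x + G x)) \<le> norm (F y - F x) + norm (G y - G x)"
    by (metis norm_triangle_ineq)
  with \<open>x \<le> y\<close> show "norm (F y + G y - (F x + G x)) \<le> 1 * (norm (F y - F x) + norm (G y - G x) + (y - x))"
    by simp
qed simp

lemma AC_on_interval_scaleR:
  assumes AC: "AC_on_interval a b F" and F: "continuous_on {a..b} F"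
    and p: "\<And>x. x \<in> {a..b} \<Longrightarrow> (p has_real_derivative p' x) (at x)"
    and p': "continuous_on {a..b} p'"
  shows "AC_on_interval a b (\<lambda>r. p r *\<^sub>R F r)"
proof -
  have pc: "continuous_on {a..b} p"
    using p by (meson DERIV_continuous_on has_field_derivative_at_within)
  have "bounded (F ` {a..b})" "bounded (p ` {a..b})" "bounded (p' ` {a..b})"
    using F p' pc by (auto intro!: compact_imp_bounded compact_continuous_image)
  then obtain K1 K2 K3 where K: "\<And>x. x \<in> {a..b} \<Longrightarrow> norm (F x) \<le> K1"
      "\<And>x. x \<in> {a..b} \<Longrightarrow> \<bar>p x\<bar> \<le> K2" "\<And>x. x \<in> {a..b} \<Longrightarrow> \<bar>p' x\<bar> \<le> K3"
    unfolding bounded_iff ball_simps real_norm_def by blast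
  define K where "K = \<bar>K2\<bar> + \<bar>K3\<bar> * \<bar>K1\<bar>"
  show ?thesis
  proof (rule AC_on_interval_dominated[OF AC AC, of K])
    show "K \<ge> 0" by (simp add: K_def)
    fix x y :: real assume xy: "a \<le> x" "x \<le> y" "y \<le> b"
    have lip: "norm (p y - p x) \<le> K3 * norm (y - x)"
    proof (rule field_differentiable_bound[of "{a..b}" p p'])
      show "(p has_field_derivative p' z) (at z within {a..b})" if "z \<in> {a..b}" for z
        using p[OF that] by (rule has_field_derivative_at_within)
    qed (use xy K(3) in auto)
    have "p y *\<^sub>R F y - p x *\<^sub>R F x = p y *\<^sub>R (F y - F x) + (p y - p x) *\<^sub>R F x"
      by (simp add: algebra_simps)
    then have "norm (p y *\<^sub>R F y - p x *\<^sub>R F x) \<le> \<bar>p y\<bar> * norm (F y - F x) + \<bar>p y - p x\<bar> * norm (F x)"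
      by (metis norm_scaleR norm_triangle_ineq)
    also have "\<dots> \<le> \<bar>K2\<bar> * norm (F y - F x) + (\<bar>K3\<bar> * (y - x)) * \<bar>K1\<bar>"
    proof (intro add_mono mult_mono)
      show "\<bar>p y\<bar> \<le> \<bar>K2\<bar>" using K(2)[of y] xy by simp
      show "norm (F x) \<le> \<bar>K1\<bar>" using K(1)[of x] xy by simp
      have "K3 * norm (y - x) \<le> \<bar>K3\<bar> * (y - x)" using xy by (auto intro!: mult_right_mono)
      then show "\<bar>p y - p x\<bar> \<le> \<bar>K3\<bar> * (y - x)" using lip by simp
    qed (use xy in auto)
    also have "\<dots> = \<bar>K2\<bar> * norm (F y - F x) + (\<bar>K3\<bar> * \<bar>K1\<bar>) * (y - x)" by simp
    also have "\<dots> \<le> K * norm (F y - F x) + K * (y - x)"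
      using xy by (intro add_mono mult_right_mono) (auto simp: K_def)
    also have "\<dots> \<le> K * (norm (F y - F x) + norm (F y - F x) + (y - x))"
      using \<open>K \<ge> 0\<close> by (simp add: algebra_simps)
    finally show "norm (p y *\<^sub>R F y - p x *\<^sub>R F x) \<le> K * (norm (F y - F x) + norm (F y - F x) + (y - x))" .
  qed
qed

lemma AC_on_interval_cong:
  assumes AC: "AC_on_interval a b F" and eq: "\<And>x. x \<in> {a..b} \<Longrightarrow> G x = F x"
  shows "AC_on_interval a b G"
  by (rule AC_on_interval_dominated[OF AC AC, of 1]) (auto simp: eq)

lemma AC_on_interval_subset:
  assumes AC: "AC_on_interval a b F" and sub: "a \<le> c" "d \<le> b"
  shows "AC_on_interval c d F"
  unfolding AC_on_interval_def
proof (intro allI impI)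
  fix e :: real assume "e > 0"
  from AC[unfolded AC_on_interval_def, THEN spec, THEN mp, OF this]
  obtain \<eta> where \<eta>: "\<eta> > 0 \<and> (\<forall>(n::nat) u v. (\<forall>i<n. a \<le> u i \<and> u i \<le> v i \<and> v i \<le> b) \<and>
      disjoint_family_on (\<lambda>i. {u i<..<v i}) {..<n} \<and>
      (\<Sum>i<n. v i - u i) < \<eta> \<longrightarrow> (\<Sum>i<n. norm (F (v i) - F (u i))) < e)" ..
  have "\<forall>(n::nat) u v. (\<forall>i<n. c \<le> u i \<and> u i \<le> v i \<and> v i \<le> d) \<and>
      disjoint_family_on (\<lambda>i. {u i<..<v i}) {..<n} \<and>
      (\<Sum>i<n. v i - u i) < \<eta> \<longrightarrow> (\<Sum>i<n. norm (F (v i) - F (u i))) < e"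
  proof (intro allI impI)
    fix n :: nat and u v :: "nat \<Rightarrow> real"
    assume A: "(\<forall>i<n. c \<le> u i \<and> u i \<le> v i \<and> v i \<le> d) \<and>
      disjoint_family_on (\<lambda>i. {u i<..<v i}) {..<n} \<and> (\<Sum>i<n. v i - u i) < \<eta>"
    show "(\<Sum>i<n. norm (F (v i) - F (u i))) < e"
      by (rule \<eta>[THEN conjunct2, rule_format]) (use A sub in fastforce)
  qed
  with \<eta> show "\<exists>\<eta>>0. \<forall>(n::nat) u v. (\<forall>i<n. c \<le> u i \<and> u i \<le> v i \<and> v i \<le> d) \<and>
      disjoint_family_on (\<lambda>i. {u i<..<v i}) {..<n} \<and>
      (\<Sum>i<n. v i - u i) < \<eta> \<longrightarrow> (\<Sum>i<n. norm (F (v i) - F (u i))) < e"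
    by (intro exI[of _ \<eta>] conjI) (auto simp: conjunct1)
qed

text \<open>Lebesgue's differentiation theorem on the line. The library result
\<open>integrable_ccontinuous_explicit\<close> controls the averages over boxes with lower corner \<open>x\<close>, which in
one dimension is the right-hand derivative; applied to the reflected function it gives the
left-hand derivative.\<close>

lemma indefinite_integral_has_vector_derivative_ae:
  fixes g :: "real \<Rightarrow> 'a::euclidean_space"
  assumes g: "g integrable_on {a..b}"
  obtains N where "negligible N"
    "\<And>x. x \<in> {a<..<b} - N \<Longrightarrow> ((\<lambda>r. integral {a..r} g) has_vector_derivative g x) (at x)"
proof -
  define g0 where "g0 = (\<lambda>x. if x \<in> {a..b} then g x else 0)"
  have g0: "g0 integrable_on UNIV"
    unfolding g0_def using g by (simp only: integrable_restrict_UNIV)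
  then have *: "g0 integrable_on cbox u v" for u v
    using integrable_on_subcbox by blast
  have **: "(\<lambda>x. g0 (- x)) integrable_on cbox u v" for u v :: real
    using *[of "-v" "-u"] Henstock_Kurzweil_Integration.integrable_reflect_real[where f=g0 and a="-v" and b="-u"] by (simp del: Henstock_Kurzweil_Integration.integrable_reflect_real)
  obtain N1 where N1: "negligible N1" "\<And>x e. \<lbrakk>x \<notin> N1; 0 < e\<rbrakk> \<Longrightarrow>
      \<exists>d>0. \<forall>h. 0 < h \<and> h < d \<longrightarrow>
        norm (integral (cbox x (x + h *\<^sub>R One)) g0 /\<^sub>R h ^ DIM(real) - g0 x) < e"
    using integrable_ccontinuous_explicit[OF *] by blast
  obtain N2 where N2: "negligible N2" "\<And>x e. \<lbrakk>x \<notin> N2; 0 < e\<rbrakk> \<Longrightarrow>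
      \<exists>d>0. \<forall>h. 0 < h \<and> h < d \<longrightarrow>
        norm (integral (cbox x (x + h *\<^sub>R One)) (\<lambda>x. g0 (- x)) /\<^sub>R h ^ DIM(real) - g0 (- x)) < e"
    using integrable_ccontinuous_explicit[OF **] by blast
  show thesis
  proof
    \<comment> \<open>\<open>N2\<close> belongs to the reflected function, so its points are reflected back.\<close>
    show "negligible (N1 \<union> uminus ` N2)"
      using N1(1) N2(1)
      by (intro negligible_Un negligible_differentiable_image_negligible) (auto intro!: derivative_intros)
  next
    fix x assume x: "x \<in> {a<..<b} - (N1 \<union> uminus ` N2)"
    then have xN: "x \<notin> N1" "- x \<notin> N2" by force+
    show "((\<lambda>r. integral {a..r} g) has_vector_derivative g x) (at x)"
      unfolding has_vector_derivative_def has_derivative_within_alt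
    proof (intro conjI allI impI bounded_linear_scaleR_left)
      fix e :: real assume "e > 0"
      obtain d1 where d1: "d1 > 0" "\<And>h. 0 < h \<Longrightarrow> h < d1 \<Longrightarrow> norm (integral {x..x+h} g0 /\<^sub>R h - g0 x) < e"
        using N1(2)[OF xN(1) \<open>e > 0\<close>] by auto
      obtain d2 where d2: "d2 > 0" "\<And>h. 0 < h \<Longrightarrow> h < d2 \<Longrightarrow>
            norm (integral {-x..-x+h} (\<lambda>x. g0 (- x)) /\<^sub>R h - g0 x) < e"
        using N2(2)[OF xN(2) \<open>e > 0\<close>] by auto
      define d where "d = min (min d1 d2) (min (x - a) (b - x))"
      have "d > 0" using d1 d2 x by (auto simp: d_def)
      have eq: "integral {u..v} g0 = integral {a..v} g - integral {a..u} g"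
        if "a \<le> u" "u \<le> v" "v \<le> b" for u v
      proof -
        have "integral {u..v} g0 = integral {u..v} g"
          using that by (intro Henstock_Kurzweil_Integration.integral_cong) (auto simp: g0_def)
        then show ?thesis using integral_Icc_diff[OF g that] by simp
      qed
      have mult: "norm (i - h *\<^sub>R g x) \<le> e * h" if "norm (i /\<^sub>R h - g x) < e" "h > 0" for i h
      proof -
        have "i - h *\<^sub>R g x = h *\<^sub>R (i /\<^sub>R h - g x)"
          using that by (simp add: scaleR_diff_right)
        then have "norm (i - h *\<^sub>R g x) = h * norm (i /\<^sub>R h - g x)"
          using that(2) by simp
        then show ?thesis using that by (simp add: mult.commute)
      qed
      have gx: "g0 x = g x" using x by (auto simp: g0_def)
      have "norm (integral {a..y} g - integral {a..x} g - (y - x) *\<^sub>R g x) \<le> e * norm (y - x)"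
        if y: "norm (y - x) < d" for y
      proof (cases y x rule: linorder_cases)
        case less
        have "integral {-x..-x+(x-y)} (\<lambda>x. g0 (- x)) = integral {y..x} g0"
          using Henstock_Kurzweil_Integration.integral_reflect_real[of x y g0] by simp
        then have "norm (integral {y..x} g0 /\<^sub>R (x - y) - g x) < e"
          using d2(2)[of "x - y"] less y gx by (simp add: d_def)
        then have "norm (integral {y..x} g0 - (x - y) *\<^sub>R g x) \<le> e * (x - y)"
          using less by (intro mult) auto
        also have "integral {y..x} g0 = integral {a..x} g - integral {a..y} g"
          using y x less by (intro eq) (auto simp: d_def)
        also have "integral {a..x} g - integral {a..y} g - (x - y) *\<^sub>R g x
            = - (integral {a..y} g - integral {a..x} g - (y - x) *\<^sub>R g x)"
          by (simp add: algebra_simps)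
        finally show ?thesis using less by (simp only: norm_minus_cancel real_norm_def) simp
      next
        case greater
        have "norm (integral {x..y} g0 /\<^sub>R (y - x) - g x) < e"
          using d1(2)[of "y - x"] greater y gx by (simp add: d_def)
        then have "norm (integral {x..y} g0 - (y - x) *\<^sub>R g x) \<le> e * (y - x)"
          using greater by (intro mult) auto
        also have "integral {x..y} g0 = integral {a..y} g - integral {a..x} g"
          using y x greater by (intro eq) (auto simp: d_def)
        finally show ?thesis using greater by simp
      qed simp
      then show "\<exists>d>0. \<forall>y\<in>UNIV. norm (y - x) < d \<longrightarrow>
          norm (integral {a..y} g - integral {a..x} g - (y - x) *\<^sub>R g x) \<le> e * norm (y - x)"
        using \<open>d > 0\<close> by blast
    qed
  qed
qed

section \<open>Variation of parameters with an integrable source\<close>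

lemma has_vector_derivative_iff_slope:
  "(f has_vector_derivative D) (at x within S) \<longleftrightarrow>
     ((\<lambda>y. (f y - f x) /\<^sub>R (y - x)) \<longlongrightarrow> D) (at x within S)"
proof -
  have "norm (f y - f x - (y - x) *\<^sub>R D) / norm (y - x) = norm ((f y - f x) /\<^sub>R (y - x) - D)"
    if "y \<noteq> x" for y
  proof -
    have "f y - f x - (y - x) *\<^sub>R D = (y - x) *\<^sub>R ((f y - f x) /\<^sub>R (y - x) - D)"
      using that by (simp add: scaleR_diff_right)
    then show ?thesis using that by simp
  qed
  then have "((\<lambda>y. norm (f y - f x - (y - x) *\<^sub>R D) / norm (y - x)) \<longlongrightarrow> 0) (at x within S) \<longleftrightarrow>
     ((\<lambda>y. norm ((f y - f x) /\<^sub>R (y - x) - D)) \<longlongrightarrow> 0) (at x within S)"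
    by (intro tendsto_cong) (auto simp: eventually_at_filter)
  then show ?thesis
    by (simp add: has_vector_derivative_def has_derivative_iff_norm bounded_linear_scaleR_left
        tendsto_norm_zero_iff LIM_zero_iff)
qed

text \<open>The product rule at a zero of one factor, where continuity of the other factor suffices.\<close>

lemma has_vector_derivative_scaleR_zero:
  assumes \<phi>: "(\<phi> has_real_derivative d) (at x within S)" "\<phi> x = 0"
    and A: "continuous (at x within S) A"
  shows "((\<lambda>y. \<phi> y *\<^sub>R A y) has_vector_derivative d *\<^sub>R A x) (at x within S)"
proof -
  have "((\<lambda>y. (\<phi> y / (y - x)) *\<^sub>R A y) \<longlongrightarrow> d *\<^sub>R A x) (at x within S)"
    using assms by (intro tendsto_scaleR) (auto simp: has_field_derivative_iff continuous_within)
  then show ?thesis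
    using \<phi>(2) by (simp add: has_vector_derivative_iff_slope divide_inverse mult.commute)
qed

text \<open>Split the increment at \<open>x\<close> into the changes of the outer factors \<open>p\<close> and \<open>q\<close>, which give the stated
derivative because the primitives are continuous, and the remainder, which is the integral of
\<open>(p(x) q(s) - q(x) p(s)) g(s)\<close> between \<open>x\<close> and \<open>y\<close>. The bracket vanishes at \<open>s = x\<close>, hence is
\<open>O(|s - x|)\<close>, and the integral of \<open>|g|\<close> over the same interval tends to \<open>0\<close>: the remainder is
\<open>o(|y - x|)\<close> at every point \<open>x\<close>.\<close>

lemma variation_of_parameters_derivative:
  fixes g :: "real \<Rightarrow> 'a::euclidean_space"
  assumes q_int: "(\<lambda>s. q s *\<^sub>R g s) integrable_on {a..b}"
    and p_int: "(\<lambda>s. p s *\<^sub>R g s) integrable_on {a..b}"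
    and g_int: "(\<lambda>s. norm (g s)) integrable_on {a..b}"
    and x: "a < x" "x \<le> b"
    and p: "(p has_real_derivative p') (at x)"
    and q: "(q has_real_derivative q') (at x)"
  shows "((\<lambda>r. p r *\<^sub>R integral {a..r} (\<lambda>s. q s *\<^sub>R g s) - q r *\<^sub>R integral {a..r} (\<lambda>s. p s *\<^sub>R g s))
    has_vector_derivative
      p' *\<^sub>R integral {a..x} (\<lambda>s. q s *\<^sub>R g s) - q' *\<^sub>R integral {a..x} (\<lambda>s. p s *\<^sub>R g s))
    (at x within {a..b})"
proof -
  define A where "A = (\<lambda>r. integral {a..r} (\<lambda>s. q s *\<^sub>R g s))"
  define B where "B = (\<lambda>r. integral {a..r} (\<lambda>s. p s *\<^sub>R g s))"
  define H where "H = (\<lambda>r. integral {a..r} (\<lambda>s. norm (g s)))"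
  define \<kappa> where "\<kappa> = (\<lambda>s. p x * q s - q x * p s)"
  \<comment> \<open>The outer factors are frozen at \<open>x\<close>; what remains is the second-order part of the increment.\<close>
  define R where "R = (\<lambda>y. p x *\<^sub>R A y - q x *\<^sub>R B y)"
  have xab: "x \<in> {a..b}" using x by auto
  have contA: "continuous (at x within {a..b}) A" and contB: "continuous (at x within {a..b}) B"
    using indefinite_integral_continuous_1[OF q_int] indefinite_integral_continuous_1[OF p_int] xab
    by (auto simp: A_def B_def continuous_on_eq_continuous_within)
  have R_diff: "norm (R v - R u) \<le> K * (H v - H u)"
    if uv: "a \<le> u" "u \<le> v" "v \<le> b" and K: "\<And>s. s \<in> {u..v} \<Longrightarrow> \<bar>\<kappa> s\<bar> \<le> K" for u v K
  proof -
    have sub: "f integrable_on {u..v}" if "f integrable_on {a..b}" for f :: "real \<Rightarrow> 'b::euclidean_space"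
      using that by (rule integrable_on_subinterval) (use uv in auto)
    have "A v - A u = integral {u..v} (\<lambda>s. q s *\<^sub>R g s)" "B v - B u = integral {u..v} (\<lambda>s. p s *\<^sub>R g s)"
      unfolding A_def B_def using x uv by (auto intro!: integral_Icc_diff q_int p_int)
    then have "R v - R u = p x *\<^sub>R integral {u..v} (\<lambda>s. q s *\<^sub>R g s) - q x *\<^sub>R integral {u..v} (\<lambda>s. p s *\<^sub>R g s)"
      by (simp add: R_def algebra_simps)
    also have "\<dots> = integral {u..v} (\<lambda>s. p x *\<^sub>R (q s *\<^sub>R g s) - q x *\<^sub>R (p s *\<^sub>R g s))"
      by (subst Henstock_Kurzweil_Integration.integral_diff)
         (auto simp del: scaleR_scaleR intro!: integrable_cmul sub q_int p_int)
    also have "\<dots> = integral {u..v} (\<lambda>s. \<kappa> s *\<^sub>R g s)"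
      by (simp add: \<kappa>_def algebra_simps)
    finally have eq: "R v - R u = integral {u..v} (\<lambda>s. \<kappa> s *\<^sub>R g s)" .
    have "(\<lambda>s. p x *\<^sub>R (q s *\<^sub>R g s) - q x *\<^sub>R (p s *\<^sub>R g s)) integrable_on {u..v}"
      by (intro integrable_diff integrable_cmul sub q_int p_int)
    then have \<kappa>_int: "(\<lambda>s. \<kappa> s *\<^sub>R g s) integrable_on {u..v}"
      by (simp add: \<kappa>_def algebra_simps)
    have gK: "(\<lambda>s. K * norm (g s)) integrable_on {u..v}"
      by (intro integrable_on_mult_right sub g_int)
    have "norm (R v - R u) \<le> integral {u..v} (\<lambda>s. K * norm (g s))"
      unfolding eq
      by (rule Henstock_Kurzweil_Integration.integral_norm_bound_integral[OF \<kappa>_int gK])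
         (auto intro!: mult_right_mono K)
    also have "\<dots> = K * (H v - H u)"
      using integral_Icc_diff[OF g_int, of u v] uv by (simp add: H_def)
    finally show ?thesis .
  qed
  have dp: "((\<lambda>y. p y - p x) has_real_derivative p') (at x within {a..b})"
    using has_field_derivative_at_within[OF DERIV_diff[OF p DERIV_const[of "p x"]]] by simp
  have dq: "((\<lambda>y. q y - q x) has_real_derivative q') (at x within {a..b})"
    using has_field_derivative_at_within[OF DERIV_diff[OF q DERIV_const[of "q x"]]] by simp
  have "(R has_vector_derivative 0) (at x within {a..b})"
    unfolding has_vector_derivative_def has_derivative_within_alt
  proof (intro conjI allI impI bounded_linear_scaleR_left)
    fix e :: real assume "e > 0"
    have d\<kappa>: "(\<kappa> has_real_derivative (p x * q' - q x * p')) (at x)"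
      unfolding \<kappa>_def by (auto intro!: derivative_eq_intros p q)
    define K where "K = \<bar>p x * q' - q x * p'\<bar> + 1"
    have "K > 0" by (simp add: K_def)
    obtain d1 where d1: "d1 > 0"
      "\<And>s. \<bar>s - x\<bar> < d1 \<Longrightarrow> \<bar>\<kappa> s - \<kappa> x - (p x * q' - q x * p') * (s - x)\<bar> \<le> 1 * \<bar>s - x\<bar>"
      using d\<kappa>[unfolded has_field_derivative_def has_derivative_within_alt, THEN conjunct2, rule_format, of 1]
      by auto
    have \<kappa>_le: "\<bar>\<kappa> s\<bar> \<le> K * \<bar>s - x\<bar>" if "\<bar>s - x\<bar> < d1" for s
    proof -
      have aux: "\<bar>u\<bar> \<le> \<bar>v\<bar> + w" if "\<bar>u - v\<bar> \<le> w" for u v w :: real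
        using that by linarith
      have "\<kappa> x = 0" by (simp add: \<kappa>_def)
      with d1(2)[OF that] have "\<bar>\<kappa> s - (p x * q' - q x * p') * (s - x)\<bar> \<le> \<bar>s - x\<bar>" by simp
      then have "\<bar>\<kappa> s\<bar> \<le> \<bar>(p x * q' - q x * p') * (s - x)\<bar> + \<bar>s - x\<bar>" by (rule aux)
      then show ?thesis by (simp only: K_def abs_mult distrib_right mult_1)
    qed
    have "continuous_on {a..b} H"
      unfolding H_def by (rule indefinite_integral_continuous_1[OF g_int])
    then obtain d2 where d2: "d2 > 0" "\<And>y. y \<in> {a..b} \<Longrightarrow> \<bar>y - x\<bar> < d2 \<Longrightarrow> \<bar>H y - H x\<bar> < e / K"
      using x \<open>e > 0\<close> \<open>K > 0\<close> unfolding continuous_on_iff dist_real_def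
      by (metis atLeastAtMost_iff divide_pos_pos less_imp_le)
    define d where "d = min (min d1 d2) (x - a)"
    have "norm (R y - R x - (y - x) *\<^sub>R 0) \<le> e * norm (y - x)"
      if y: "y \<in> {a..b}" "norm (y - x) < d" for y
    proof -
      have cy: "a \<le> y" "\<bar>y - x\<bar> < d1" "\<bar>y - x\<bar> < d2" using y by (auto simp: d_def)
      define u v where "u = min x y" and "v = max x y"
      have "norm (R v - R u) \<le> (K * \<bar>y - x\<bar>) * (H v - H u)"
      proof (rule R_diff)
        fix s assume s: "s \<in> {u..v}"
        have "\<bar>\<kappa> s\<bar> \<le> K * \<bar>s - x\<bar>" using s cy by (intro \<kappa>_le) (auto simp: u_def v_def)
        also have "\<dots> \<le> K * \<bar>y - x\<bar>"
          using s \<open>K > 0\<close> by (intro mult_left_mono) (auto simp: u_def v_def)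
        finally show "\<bar>\<kappa> s\<bar> \<le> K * \<bar>y - x\<bar>" .
      qed (use x y cy in \<open>auto simp: u_def v_def\<close>)
      also have "\<dots> \<le> (K * \<bar>y - x\<bar>) * (e / K)"
        using d2(2)[of y] cy y x \<open>K > 0\<close> by (intro mult_left_mono) (auto simp: u_def v_def min_def max_def)
      also have "\<dots> = e * \<bar>y - x\<bar>" using \<open>K > 0\<close> by simp
      finally have "norm (R v - R u) \<le> e * \<bar>y - x\<bar>" .
      moreover have "norm (R v - R u) = norm (R y - R x)"
        by (cases "x \<le> y") (auto simp: u_def v_def norm_minus_commute)
      ultimately show ?thesis by simp
    qed
    moreover have "d > 0" using d1 d2 x by (simp add: d_def)
    ultimately show "\<exists>d>0. \<forall>y\<in>{a..b}. norm (y - x) < d \<longrightarrow>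
        norm (R y - R x - (y - x) *\<^sub>R 0) \<le> e * norm (y - x)" by blast
  qed
  moreover have "((\<lambda>y. (p y - p x) *\<^sub>R A y) has_vector_derivative p' *\<^sub>R A x) (at x within {a..b})"
    by (rule has_vector_derivative_scaleR_zero[OF dp _ contA]) simp
  moreover have "((\<lambda>y. (q y - q x) *\<^sub>R B y) has_vector_derivative q' *\<^sub>R B x) (at x within {a..b})"
    by (rule has_vector_derivative_scaleR_zero[OF dq _ contB]) simp
  ultimately have "((\<lambda>y. R y + ((p y - p x) *\<^sub>R A y - (q y - q x) *\<^sub>R B y)) has_vector_derivative
      0 + (p' *\<^sub>R A x - q' *\<^sub>R B x)) (at x within {a..b})"
    by (intro has_vector_derivative_add has_vector_derivative_diff)
  moreover have "R y + ((p y - p x) *\<^sub>R A y - (q y - q x) *\<^sub>R B y) = p y *\<^sub>R A y - q y *\<^sub>R B y" for y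
    by (simp add: R_def scaleR_diff_left)
  ultimately show ?thesis
    by (simp only: A_def B_def add_0)
qed

section \<open>Derivatives and asymptotics at the origin\<close>

lemma powr_tendsto_0_within:
  assumes "a > 0" shows "((\<lambda>r::real. r powr a) \<longlongrightarrow> 0) (at 0 within {0..1})"
proof -
  have "((\<lambda>r::real. r powr a) \<longlongrightarrow> 0 powr a) (at 0 within {0..1})"
    using assms by (intro tendsto_powr2) (auto simp: eventually_at_filter)
  then show ?thesis by simp
qed

text \<open>At the origin the variation-of-parameters formula degenerates; there the iterates and \<open>w\<close> are
differentiable for the reason that they vanish to an order greater than \<open>1\<close>.\<close>

lemma has_vector_derivative_zero_at_0:
  fixes u :: "real \<Rightarrow> complex"
  assumes "a > 0" "u 0 = 0" and u: "\<And>r. 0 < r \<Longrightarrow> r \<le> 1 \<Longrightarrow> norm (u r) \<le> r powr (a + 1) * K"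
  shows "(u has_vector_derivative 0) (at 0 within {0..1})"
proof -
  have "((\<lambda>y. (u y - u 0) /\<^sub>R (y - 0)) \<longlongrightarrow> 0) (at 0 within {0..1})"
  proof (rule Lim_null_comparison)
    show "((\<lambda>r. r powr a * K) \<longlongrightarrow> 0) (at 0 within {0..1})"
      using powr_tendsto_0_within[OF \<open>a > 0\<close>] by (rule tendsto_mult_left_zero)
    have "norm ((u y - u 0) /\<^sub>R (y - 0)) \<le> y powr a * K" if "0 < y" "y \<le> 1" for y
      using u[OF that] that \<open>u 0 = 0\<close> by (simp add: powr_add field_simps)
    then show "\<forall>\<^sub>F y in at 0 within {0..1}. norm ((u y - u 0) /\<^sub>R (y - 0)) \<le> y powr a * K"
      by (auto simp: eventually_at_filter less_eq_real_def)
  qed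
  then show ?thesis by (simp add: has_vector_derivative_iff_slope)
qed

lemma deriv01_eq:
  assumes "(f has_vector_derivative D) (at r within {0..1})" "r \<in> {0..1}"
  shows "deriv01 f r = D"
  unfolding deriv01_def
  using vector_derivative_within_cbox[of 0 1 r f D] assms by simp

text \<open>A relative error that tends to \<open>0\<close> is asymptotic equivalence.\<close>

lemma asymp_equiv_at_right_0_of_bound:
  fixes f :: "real \<Rightarrow> complex" and g e :: "real \<Rightarrow> real"
  assumes bound: "\<And>r. 0 < r \<Longrightarrow> r \<le> 1 \<Longrightarrow> norm (f r - of_real (g r)) \<le> g r * e r"
    and g: "\<And>r. 0 < r \<Longrightarrow> r \<le> 1 \<Longrightarrow> 0 < g r"
    and e: "(e \<longlongrightarrow> 0) (at 0 within {0..1})"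
  shows "f \<sim>[at_right 0] (\<lambda>r. of_real (g r))"
proof (rule asymp_equivI', rule Lim_transform2[OF tendsto_const])
  have "((\<lambda>r. f r / of_real (g r) - 1) \<longlongrightarrow> 0) (at 0 within {0..1})"
  proof (rule Lim_null_comparison[OF _ e])
    have "norm (f r / of_real (g r) - 1) \<le> e r" if r: "0 < r" "r \<le> 1" for r
    proof -
      have "f r / of_real (g r) - 1 = (f r - of_real (g r)) / of_real (g r)"
        using g[OF r] by (simp add: field_simps)
      also have "norm \<dots> = norm (f r - of_real (g r)) / g r"
        using g[OF r] by (simp add: norm_divide)
      also have "\<dots> \<le> e r"
        using bound[OF r] g[OF r] by (simp add: divide_le_eq mult.commute)
      finally show ?thesis .
    qed
    then show "\<forall>\<^sub>F r in at 0 within {0..1}. norm (f r / of_real (g r) - 1) \<le> e r"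
      by (auto simp: eventually_at_filter less_eq_real_def)
  qed
  then show "((\<lambda>r. 1 - f r / of_real (g r)) \<longlongrightarrow> 0) (at_right 0)"
    using tendsto_minus by (fastforce simp: at_within_Icc_at_right)
qed

section \<open>The Green operator of the unperturbed Bessel equation\<close>

lemma absolutely_integrable_on_Ioo_iff:
  fixes f :: "real \<Rightarrow> 'a::euclidean_space"
  shows "f absolutely_integrable_on {a<..<b} \<longleftrightarrow> f absolutely_integrable_on {a..b}"
  by (metis absolutely_integrable_on_open_interval box_real)

locale bessel_potential =
  fixes l :: real and V :: "real \<Rightarrow> complex"
  assumes l_pos: "l > 0"
    and V_meas: "V \<in> borel_measurable (lebesgue_on {0<..<1})"
    and V_int: "set_integrable lebesgue {0<..<1} (\<lambda>r. r * norm (V r))"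
begin

text \<open>The factor \<open>2\<close> accounts for the two terms of the kernel, which are estimated separately; it makes
the bounds on the Green operator free of constants.\<close>

definition weight :: "real \<Rightarrow> real" where
  "weight s = 2 * (s * norm (V s))"

text \<open>The coefficients of the free solutions \<open>r\<^sup>l\<^sup>+\<^sup>1\<close> (regular) and \<open>r\<^sup>-\<^sup>l\<close> (singular at the origin) in
the variation-of-parameters formula for the source \<open>V f\<close>.\<close>

definition regular_coeff :: "(real \<Rightarrow> complex) \<Rightarrow> real \<Rightarrow> complex" where
  "regular_coeff f r = integral {0..r} (\<lambda>s. (s powr - l) *\<^sub>R (V s * f s))"

definition singular_coeff :: "(real \<Rightarrow> complex) \<Rightarrow> real \<Rightarrow> complex" where
  "singular_coeff f r = integral {0..r} (\<lambda>s. (s powr (l + 1)) *\<^sub>R (V s * f s))"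

definition green :: "(real \<Rightarrow> complex) \<Rightarrow> real \<Rightarrow> complex" where
  "green f r = (1 / (2 * l + 1)) *\<^sub>R
     (r powr (l + 1) *\<^sub>R regular_coeff f r - r powr - l *\<^sub>R singular_coeff f r)"

definition green_deriv :: "(real \<Rightarrow> complex) \<Rightarrow> real \<Rightarrow> complex" where
  "green_deriv f r = (1 / (2 * l + 1)) *\<^sub>R
     (((l + 1) * r powr l) *\<^sub>R regular_coeff f r + (l * r powr (- l - 1)) *\<^sub>R singular_coeff f r)"

text \<open>Vanishing to the order \<open>l + 1\<close> at the origin, up to the factor \<open>h\<close>, is what makes \<open>s\<^sup>-\<^sup>l V(s) f(s)\<close>
integrable when only \<open>s V(s)\<close> is.\<close>

definition source_bound :: "(real \<Rightarrow> complex) \<Rightarrow> (real \<Rightarrow> real) \<Rightarrow> bool" where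
  "source_bound f h \<longleftrightarrow> continuous_on {0<..1} f \<and> continuous_on {0..1} h \<and>
     (\<forall>s\<in>{0<..1}. norm (f s) \<le> s powr (l + 1) * h s)"

lemma weight_integrable: "weight absolutely_integrable_on {0..1}"
proof -
  have "(\<lambda>s. s * norm (V s)) absolutely_integrable_on {0..1}"
    using V_int by (rule absolutely_integrable_on_Ioo_iff[THEN iffD1])
  then show ?thesis unfolding weight_def by (intro set_integrable_mult_right)
qed

lemma weight_nonneg: "s \<in> {0..1} \<Longrightarrow> 0 \<le> weight s"
  by (simp add: weight_def)

lemma weight_mult_integrable:
  assumes "continuous_on {0..1} h" "r \<le> 1"
  shows "(\<lambda>s. weight s * h s) integrable_on {0..r}"
proof -
  have "(\<lambda>s. weight s * h s) integrable_on {0..1}"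
    using absolutely_integrable_mult_continuous[OF weight_integrable assms(1)]
      set_lebesgue_integral_eq_integral(1) by blast
  then show ?thesis by (rule integrable_on_subinterval) (use assms in auto)
qed

lemma source_bound_nonneg:
  assumes "source_bound f h" "0 < s" "s \<le> 1" shows "0 \<le> h s"
proof -
  have "norm (f s) \<le> s powr (l + 1) * h s"
    using assms by (simp add: source_bound_def)
  then have "0 \<le> s powr (l + 1) * h s"
    by (rule order_trans[OF norm_ge_zero])
  then show ?thesis using assms by (simp add: zero_le_mult_iff)
qed

lemma source_bound_le:
  assumes "source_bound f h" "0 < s" "s \<le> 1" shows "norm (f s) \<le> s powr l * s * h s"
  using assms by (auto simp: source_bound_def powr_add)

lemma powr_l_le_1: "0 \<le> s \<Longrightarrow> s \<le> 1 \<Longrightarrow> s powr l \<le> 1" for s :: real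
  using l_pos by (simp add: powr_le1)

text \<open>The sources occur with three multipliers \<open>c\<close>: the two free solutions and \<open>1\<close>. For each of them
\<open>|c(s)| s\<^sup>l\<close> is bounded by \<open>1\<close>, which reduces integrability to that of \<open>\<rho> h\<close>.\<close>

lemma source_integrable:
  assumes f: "source_bound f h" and c: "continuous_on {0<..<1} c"
    and cb: "\<And>s. 0 < s \<Longrightarrow> s < 1 \<Longrightarrow> \<bar>c s\<bar> * s powr l \<le> 1"
  shows "(\<lambda>s. c s *\<^sub>R (V s * f s)) absolutely_integrable_on {0..1}"
proof -
  have "(\<lambda>s. c s *\<^sub>R (V s * f s)) absolutely_integrable_on {0<..<1}"
  proof (rule measurable_bounded_by_integrable_imp_absolutely_integrable)
    have "f \<in> borel_measurable (lebesgue_on {0<..<1})"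
      using f by (intro continuous_imp_measurable_on_sets_lebesgue)
        (auto simp: source_bound_def intro: continuous_on_subset)
    moreover have "c \<in> borel_measurable (lebesgue_on {0<..<1})"
      using c by (intro continuous_imp_measurable_on_sets_lebesgue) auto
    ultimately show "(\<lambda>s. c s *\<^sub>R (V s * f s)) \<in> borel_measurable (lebesgue_on {0<..<1})"
      using V_meas by measurable
    show "(\<lambda>s. weight s * h s) integrable_on {0<..<1}"
      using weight_mult_integrable[of h 1] f
      by (simp add: source_bound_def integrable_on_open_interval_real)
    fix s :: real assume s: "s \<in> {0<..<1}"
    have h: "0 \<le> h s" using source_bound_nonneg[OF f] s by simp
    have "norm (c s *\<^sub>R (V s * f s)) = \<bar>c s\<bar> * norm (V s) * norm (f s)"
      by (simp add: norm_mult)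
    also have "\<dots> \<le> \<bar>c s\<bar> * norm (V s) * (s powr l * s * h s)"
      using s by (intro mult_left_mono source_bound_le[OF f]) auto
    also have "\<dots> = (\<bar>c s\<bar> * s powr l) * (s * norm (V s) * h s)" by simp
    also have "\<dots> \<le> 2 * (s * norm (V s) * h s)"
      using cb[of s] s h by (intro mult_right_mono) auto
    finally show "norm (c s *\<^sub>R (V s * f s)) \<le> weight s * h s"
      by (simp add: weight_def)
  qed auto
  then show ?thesis
    by (rule absolutely_integrable_on_Ioo_iff[THEN iffD1])
qed

lemma regular_source_integrable:
  assumes "source_bound f h"
  shows "(\<lambda>s. (s powr - l) *\<^sub>R (V s * f s)) absolutely_integrable_on {0..1}"
  using assms by (rule source_integrable) (auto intro!: continuous_intros simp: powr_minus)

lemma singular_source_integrable: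
  assumes "source_bound f h"
  shows "(\<lambda>s. (s powr (l + 1)) *\<^sub>R (V s * f s)) absolutely_integrable_on {0..1}"
proof (rule source_integrable[OF assms])
  fix s :: real assume "0 < s" "s < 1"
  then show "\<bar>s powr (l + 1)\<bar> * s powr l \<le> 1"
    using l_pos by (auto intro!: mult_le_one powr_le1)
qed (auto intro!: continuous_intros)

lemma plain_source_integrable:
  assumes "source_bound f h"
  shows "(\<lambda>s. V s * f s) absolutely_integrable_on {0..1}"
  using source_integrable[OF assms, of "\<lambda>s. 1"] powr_l_le_1 by simp

lemmas source_integrable_on =
  regular_source_integrable[THEN set_lebesgue_integral_eq_integral(1)]
  singular_source_integrable[THEN set_lebesgue_integral_eq_integral(1)]

lemma norm_regular_source_le:
  assumes f: "source_bound f h" and s: "s \<in> {0..1}"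
  shows "norm ((s powr - l) *\<^sub>R (V s * f s)) \<le> 1/2 * (weight s * h s)"
proof (cases "s = 0")
  case False
  have "norm ((s powr - l) *\<^sub>R (V s * f s)) = s powr - l * norm (V s) * norm (f s)"
    by (simp add: norm_mult)
  also have "\<dots> \<le> s powr - l * norm (V s) * (s powr l * s * h s)"
    using s False by (intro mult_left_mono source_bound_le[OF f]) auto
  also have "\<dots> = 1/2 * (weight s * h s)"
    using False s by (simp add: powr_minus weight_def)
  finally show ?thesis .
qed (simp add: weight_def)

text \<open>The endpoint \<open>r\<close> enters because the singular coefficient has to compensate the growth of
\<open>r\<^sup>-\<^sup>l\<close>: of the factor \<open>s\<^sup>2\<^sup>l\<^sup>+\<^sup>1\<close> in the integrand the value at \<open>s = r\<close> is pulled out.\<close>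

lemma norm_singular_source_le:
  assumes f: "source_bound f h" and s: "0 \<le> s" "s \<le> r" "r \<le> 1"
  shows "norm ((s powr (l + 1)) *\<^sub>R (V s * f s)) \<le> r powr (2 * l + 1) / 2 * (weight s * h s)"
proof (cases "s = 0")
  case False
  have h: "0 \<le> h s" using source_bound_nonneg[OF f] s False by simp
  have "norm ((s powr (l + 1)) *\<^sub>R (V s * f s)) = s powr (l + 1) * norm (V s) * norm (f s)"
    by (simp add: norm_mult)
  also have "\<dots> \<le> s powr (l + 1) * norm (V s) * (s powr l * s * h s)"
    using s False by (intro mult_left_mono source_bound_le[OF f]) auto
  also have "\<dots> = (s powr (l + 1) * s powr l) * (norm (V s) * s * h s)" by simp
  also have "s powr (l + 1) * s powr l = s powr (2 * l + 1)"
    by (simp add: powr_add[symmetric])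
  also have "\<dots> * (norm (V s) * s * h s) \<le> r powr (2 * l + 1) * (norm (V s) * s * h s)"
    using s h l_pos by (intro mult_right_mono powr_mono2) auto
  also have "\<dots> = r powr (2 * l + 1) / 2 * (weight s * h s)" by (simp add: weight_def)
  finally show ?thesis .
qed (simp add: weight_def)

lemma norm_regular_coeff_le:
  assumes f: "source_bound f h" and r: "r \<in> {0..1}"
  shows "norm (regular_coeff f r) \<le> integral {0..r} (\<lambda>s. weight s * h s) / 2"
proof -
  have "norm (regular_coeff f r) \<le> integral {0..r} (\<lambda>s. 1/2 * (weight s * h s))"
    unfolding regular_coeff_def
  proof (rule Henstock_Kurzweil_Integration.integral_norm_bound_integral)
    show "(\<lambda>s. (s powr - l) *\<^sub>R (V s * f s)) integrable_on {0..r}"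
      by (rule integrable_on_subinterval[OF source_integrable_on(1)[OF f]]) (use r in auto)
    show "(\<lambda>s. 1/2 * (weight s * h s)) integrable_on {0..r}"
      using f r by (intro integrable_on_mult_right weight_mult_integrable) (auto simp: source_bound_def)
  qed (use r in \<open>auto intro!: norm_regular_source_le[OF f, simplified]\<close>)
  then show ?thesis by simp
qed

lemma norm_singular_coeff_le:
  assumes f: "source_bound f h" and r: "r \<in> {0..1}"
  shows "norm (singular_coeff f r) \<le> r powr (2 * l + 1) * integral {0..r} (\<lambda>s. weight s * h s) / 2"
proof -
  have "norm (singular_coeff f r) \<le> integral {0..r} (\<lambda>s. r powr (2 * l + 1) / 2 * (weight s * h s))"
    unfolding singular_coeff_def
  proof (rule Henstock_Kurzweil_Integration.integral_norm_bound_integral)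
    show "(\<lambda>s. (s powr (l + 1)) *\<^sub>R (V s * f s)) integrable_on {0..r}"
      by (rule integrable_on_subinterval[OF source_integrable_on(2)[OF f]]) (use r in auto)
    show "(\<lambda>s. r powr (2 * l + 1) / 2 * (weight s * h s)) integrable_on {0..r}"
      using f r by (intro integrable_on_mult_right weight_mult_integrable) (auto simp: source_bound_def)
  qed (use r in \<open>auto intro!: norm_singular_source_le[OF f, simplified]\<close>)
  then show ?thesis by simp
qed

lemma green_0: "green f 0 = 0" "green_deriv f 0 = 0"
  by (simp_all add: green_def green_deriv_def regular_coeff_def singular_coeff_def)

lemma norm_green_le:
  assumes f: "source_bound f h" and r: "r \<in> {0..1}"
  shows "norm (green f r) \<le> r powr (l + 1) * integral {0..r} (\<lambda>s. weight s * h s)"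
    and "norm (green_deriv f r) \<le> r powr l * integral {0..r} (\<lambda>s. weight s * h s)"
proof -
  define T where "T = integral {0..r} (\<lambda>s. weight s * h s)"
  have A: "norm (regular_coeff f r) \<le> T / 2"
    and B: "norm (singular_coeff f r) \<le> r powr (2 * l + 1) * T / 2"
    using norm_regular_coeff_le[OF f r] norm_singular_coeff_le[OF f r] by (simp_all add: T_def)
  then have "T \<ge> 0" using norm_ge_zero[of "regular_coeff f r"] by linarith
  have c: "1 / (2 * l + 1) \<le> 1" "1 / (2 * l + 1) > 0" using l_pos by auto
  show "norm (green f r) \<le> r powr (l + 1) * T"
  proof -
    have "norm (r powr (l + 1) *\<^sub>R regular_coeff f r - r powr - l *\<^sub>R singular_coeff f r)
        \<le> r powr (l + 1) * norm (regular_coeff f r) + r powr - l * norm (singular_coeff f r)"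
      by (intro order_trans[OF norm_triangle_ineq4]) simp
    also have "\<dots> \<le> r powr (l + 1) * (T / 2) + r powr - l * (r powr (2 * l + 1) * T / 2)"
      by (intro add_mono mult_left_mono A B) auto
    also have "r powr - l * (r powr (2 * l + 1) * T / 2) = (r powr - l * r powr (2 * l + 1)) * (T / 2)"
      by simp
    also have "r powr - l * r powr (2 * l + 1) = r powr (l + 1)"
      by (simp add: powr_add[symmetric])
    finally have *: "norm (r powr (l + 1) *\<^sub>R regular_coeff f r - r powr - l *\<^sub>R singular_coeff f r)
        \<le> r powr (l + 1) * T" by (simp add: mult.commute)
    have "norm (green f r) \<le> 1 * (r powr (l + 1) * T)"
      unfolding green_def norm_scaleR using c * \<open>T \<ge> 0\<close> by (intro mult_mono) auto
    then show ?thesis by simp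
  qed
  show "norm (green_deriv f r) \<le> r powr l * T"
  proof -
    have "norm (((l + 1) * r powr l) *\<^sub>R regular_coeff f r + (l * r powr (- l - 1)) *\<^sub>R singular_coeff f r)
        \<le> ((l + 1) * r powr l) * norm (regular_coeff f r) + (l * r powr (- l - 1)) * norm (singular_coeff f r)"
      using l_pos by (intro order_trans[OF norm_triangle_ineq]) simp
    also have "\<dots> \<le> ((l + 1) * r powr l) * (T / 2) + (l * r powr (- l - 1)) * (r powr (2 * l + 1) * T / 2)"
      using l_pos by (intro add_mono mult_left_mono A B) auto
    also have "(l * r powr (- l - 1)) * (r powr (2 * l + 1) * T / 2)
        = l * (r powr (- l - 1) * r powr (2 * l + 1)) * (T / 2)"
      by simp
    also have "r powr (- l - 1) * r powr (2 * l + 1) = r powr l"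
      by (simp add: powr_add[symmetric])
    also have "(l + 1) * r powr l * (T / 2) + l * r powr l * (T / 2) = (2 * l + 1) * (r powr l * T) / 2"
      by (simp add: algebra_simps)
    also have "\<dots> \<le> (2 * l + 1) * (r powr l * T)"
      using \<open>T \<ge> 0\<close> l_pos by simp
    finally show ?thesis
      unfolding green_deriv_def norm_scaleR using l_pos by (simp add: field_simps)
  qed
qed

lemma green_has_vector_derivative:
  assumes f: "source_bound f h" and r: "0 < r" "r \<le> 1"
  shows "(green f has_vector_derivative green_deriv f r) (at r within {0..1})"
proof -
  let ?A = "regular_coeff f" and ?B = "singular_coeff f"
  have "((\<lambda>r. r powr (l + 1) *\<^sub>R ?A r - r powr - l *\<^sub>R ?B r) has_vector_derivative
      ((l + 1) * r powr l) *\<^sub>R ?A r - (- l * r powr (- l - 1)) *\<^sub>R ?B r) (at r within {0..1})"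
    unfolding regular_coeff_def singular_coeff_def
  proof (rule variation_of_parameters_derivative)
    show "(\<lambda>s. norm (V s * f s)) integrable_on {0..1}"
      using plain_source_integrable[OF f] unfolding absolutely_integrable_on_def by simp
    show "((\<lambda>r. r powr (l + 1)) has_real_derivative (l + 1) * r powr l) (at r)"
      "((\<lambda>r. r powr - l) has_real_derivative - l * r powr (- l - 1)) (at r)"
      using r by (auto intro!: derivative_eq_intros)
  qed (use source_integrable_on[OF f] r in auto)
  then have "((\<lambda>r. (1 / (2 * l + 1)) *\<^sub>R (r powr (l + 1) *\<^sub>R ?A r - r powr - l *\<^sub>R ?B r))
      has_vector_derivative (1 / (2 * l + 1)) *\<^sub>R
      (((l + 1) * r powr l) *\<^sub>R ?A r - (- l * r powr (- l - 1)) *\<^sub>R ?B r)) (at r within {0..1})"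
    using has_vector_derivative_scaleR[OF DERIV_const] by fastforce
  then show ?thesis
    by (simp add: green_def[abs_def] green_deriv_def)
qed

lemma coeff_continuous:
  assumes f: "source_bound f h"
  shows "continuous_on {0..1} (regular_coeff f)" "continuous_on {0..1} (singular_coeff f)"
  unfolding regular_coeff_def[abs_def] singular_coeff_def[abs_def]
  by (intro indefinite_integral_continuous_1 source_integrable_on[OF f])+

lemma green_deriv_continuous:
  assumes f: "source_bound f h"
  shows "continuous_on {0<..1} (green_deriv f)"
  unfolding green_deriv_def[abs_def]
  by (intro continuous_intros continuous_on_subset[OF coeff_continuous(1)[OF f]]
      continuous_on_subset[OF coeff_continuous(2)[OF f]]) auto

lemma green_kernel:
  assumes f: "source_bound f h" and r: "0 < r" "r \<le> 1"
  shows "set_integrable lebesgue {0<..<r} (\<lambda>s. of_real (bessel_kernel l r s) * V s * f s)"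
    and "(LINT s:{0<..<r}|lebesgue. of_real (bessel_kernel l r s) * V s * f s) = green f r"
proof -
  let ?a = "\<lambda>s. (s powr - l) *\<^sub>R (V s * f s)" and ?b = "\<lambda>s. (s powr (l + 1)) *\<^sub>R (V s * f s)"
  let ?c = "\<lambda>s. (1 / (2 * l + 1)) *\<^sub>R (r powr (l + 1) *\<^sub>R ?a s - r powr - l *\<^sub>R ?b s)"
  \<comment> \<open>Valid at \<open>s = 0\<close> too, where both sides vanish by the conventions for \<open>powr\<close> and division.\<close>
  have eq: "of_real (bessel_kernel l r s) * V s * f s = ?c s" for s
    by (simp add: bessel_kernel_def scaleR_conv_of_real powr_minus field_simps)
  have ai: "?a absolutely_integrable_on {0..r}" "?b absolutely_integrable_on {0..r}"
    using regular_source_integrable[OF f] singular_source_integrable[OF f] r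
    by (auto intro: absolutely_integrable_on_subinterval)
  have "?c absolutely_integrable_on {0..r}"
    by (intro absolutely_integrable_scaleR_left set_integral_diff(1) ai)
  then have c: "set_integrable lebesgue {0<..<r} ?c"
    by (rule absolutely_integrable_on_Ioo_iff[THEN iffD2])
  then show "set_integrable lebesgue {0<..<r} (\<lambda>s. of_real (bessel_kernel l r s) * V s * f s)"
    unfolding eq .
  have i: "?a integrable_on {0..r}" "?b integrable_on {0..r}"
    using ai set_lebesgue_integral_eq_integral(1) by blast+
  have "(LINT s:{0<..<r}|lebesgue. ?c s) = integral {0..r} ?c"
    using set_lebesgue_integral_eq_integral(2)[OF c] by (simp add: integral_open_interval_real)
  also have "\<dots> = (1 / (2 * l + 1)) *\<^sub>R integral {0..r} (\<lambda>s. r powr (l + 1) *\<^sub>R ?a s - r powr - l *\<^sub>R ?b s)"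
    by (rule Henstock_Kurzweil_Integration.integral_cmul)
  also have "integral {0..r} (\<lambda>s. r powr (l + 1) *\<^sub>R ?a s - r powr - l *\<^sub>R ?b s) =
      integral {0..r} (\<lambda>s. r powr (l + 1) *\<^sub>R ?a s) - integral {0..r} (\<lambda>s. r powr - l *\<^sub>R ?b s)"
    by (intro Henstock_Kurzweil_Integration.integral_diff integrable_cmul i)
  also have "integral {0..r} (\<lambda>s. r powr (l + 1) *\<^sub>R ?a s) = r powr (l + 1) *\<^sub>R integral {0..r} ?a"
    by (rule Henstock_Kurzweil_Integration.integral_cmul)
  also have "integral {0..r} (\<lambda>s. r powr - l *\<^sub>R ?b s) = r powr - l *\<^sub>R integral {0..r} ?b"
    by (rule Henstock_Kurzweil_Integration.integral_cmul)
  finally show "(LINT s:{0<..<r}|lebesgue. of_real (bessel_kernel l r s) * V s * f s) = green f r"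
    unfolding eq by (simp only: green_def regular_coeff_def singular_coeff_def)
qed

lemma green_sum:
  fixes F :: "nat \<Rightarrow> real \<Rightarrow> complex"
  assumes F: "\<And>k. source_bound (F k) (h k)" and r: "r \<in> {0..1}"
  shows "green (\<lambda>s. \<Sum>k<n. F k s) r = (\<Sum>k<n. green (F k) r)"
proof -
  have sub: "g integrable_on {0..r}" if "g integrable_on {0..1}" for g :: "real \<Rightarrow> complex"
    using that by (rule integrable_on_subinterval) (use r in auto)
  have "regular_coeff (\<lambda>s. \<Sum>k<n. F k s) r = (\<Sum>k<n. regular_coeff (F k) r)"
    unfolding regular_coeff_def sum_distrib_left scaleR_sum_right
    by (intro Henstock_Kurzweil_Integration.integral_sum sub source_integrable_on(1)[OF F] finite_lessThan)
  moreover have "singular_coeff (\<lambda>s. \<Sum>k<n. F k s) r = (\<Sum>k<n. singular_coeff (F k) r)"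
    unfolding singular_coeff_def sum_distrib_left scaleR_sum_right
    by (intro Henstock_Kurzweil_Integration.integral_sum sub source_integrable_on(2)[OF F] finite_lessThan)
  ultimately show ?thesis
    by (simp only: green_def scaleR_sum_right sum_subtractf[symmetric])
qed

text \<open>Dominated convergence; the bound \<open>h\<close> common to all sources provides the integrable majorant.\<close>

lemma green_tendsto:
  assumes F: "\<And>n. source_bound (F n) h"
    and lim: "\<And>s. 0 < s \<Longrightarrow> s \<le> 1 \<Longrightarrow> (\<lambda>n. F n s) \<longlonglongrightarrow> f s"
    and r: "r \<in> {0..1}"
  shows "(\<lambda>n. green (F n) r) \<longlonglongrightarrow> green f r"
proof -
  have sub: "g integrable_on {0..r}" if "g integrable_on {0..1}" for g :: "real \<Rightarrow> complex"
    using that by (rule integrable_on_subinterval) (use r in auto)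
  have h: "(\<lambda>s. 1/2 * (weight s * h s)) integrable_on {0..r}"
    using F r by (intro integrable_on_mult_right weight_mult_integrable) (auto simp: source_bound_def)
  have lim': "(\<lambda>n. c *\<^sub>R (V s * F n s)) \<longlonglongrightarrow> c *\<^sub>R (V s * f s)"
    if "s \<in> {0..r}" "s = 0 \<Longrightarrow> c = 0" for s c
    using that r lim[of s] by (cases "s = 0") (auto intro!: tendsto_intros)
  have "(\<lambda>n. regular_coeff (F n) r) \<longlonglongrightarrow> regular_coeff f r"
    unfolding regular_coeff_def
  proof (rule dominated_convergence(2)[OF _ h])
    show "norm (s powr - l *\<^sub>R (V s * F n s)) \<le> 1/2 * (weight s * h s)" if "s \<in> {0..r}" for n s
      using norm_regular_source_le[OF F, of s] that r by simp
  qed (use r in \<open>auto intro!: sub source_integrable_on(1)[OF F] lim'\<close>)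
  moreover have "(\<lambda>n. singular_coeff (F n) r) \<longlonglongrightarrow> singular_coeff f r"
    unfolding singular_coeff_def
  proof (rule dominated_convergence(2)[OF _ h])
    show "norm (s powr (l + 1) *\<^sub>R (V s * F n s)) \<le> 1/2 * (weight s * h s)" if "s \<in> {0..r}" for n s
      using norm_singular_source_le[OF F, of s 1] that r by simp
  qed (use r in \<open>auto intro!: sub source_integrable_on(2)[OF F] lim'\<close>)
  ultimately show ?thesis
    unfolding green_def by (intro tendsto_intros)
qed

section \<open>The iterates\<close>

abbreviation "majorant \<equiv> volterra_majorant weight"

lemma bessel_iter_Suc:
  assumes "source_bound (bessel_iter l V k) h" "0 < r" "r \<le> 1"
  shows "bessel_iter l V (Suc k) r = green (bessel_iter l V k) r"
proof -
  have "(LINT s:{0<..<r}|lebesgue. of_real (bessel_kernel l r s) * V s * bessel_iter_pos l V k s)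
      = (LINT s:{0<..<r}|lebesgue. of_real (bessel_kernel l r s) * V s * bessel_iter l V k s)"
    by (rule set_lebesgue_integral_cong) (auto simp: bessel_iter_def)
  then show ?thesis
    using green_kernel(2)[OF assms] assms by (simp add: bessel_iter_def)
qed

lemma green_continuous:
  assumes "source_bound f h" shows "continuous_on {0<..1} (green f)"
proof -
  have "continuous (at r within {0<..1}) (green f)" if "r \<in> {0<..1}" for r
    using has_vector_derivative_continuous[OF green_has_vector_derivative[OF assms, of r]] that
    by (auto intro: continuous_within_subset)
  then show ?thesis by (simp add: continuous_on_eq_continuous_within)
qed

lemma bessel_iter_source_bound: "source_bound (bessel_iter l V k) (majorant k)"
proof (induction k)
  case 0
  have "continuous_on {0<..1} (\<lambda>r. complex_of_real (r powr (l + 1)))"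
    by (intro continuous_intros) auto
  then have "continuous_on {0<..1} (bessel_iter l V 0)"
    by (rule continuous_on_eq) (simp add: bessel_iter_def)
  then show ?case by (simp add: source_bound_def bessel_iter_def)
next
  case (Suc k)
  note eq = bessel_iter_Suc[OF Suc]
  have "continuous_on {0<..1} (bessel_iter l V (Suc k))"
    using green_continuous[OF Suc] by (rule continuous_on_eq) (simp add: eq)
  moreover have "norm (bessel_iter l V (Suc k) s) \<le> s powr (l + 1) * majorant (Suc k) s"
    if "s \<in> {0<..1}" for s
    using norm_green_le(1)[OF Suc, of s] that by (simp add: eq)
  ultimately show ?case
    using volterra_majorant_continuous[OF weight_integrable weight_nonneg, of "Suc k"]
    by (simp add: source_bound_def)
qed

lemma majorant_le:
  assumes "r \<in> {0..1}" shows "majorant k r \<le> majorant k 1"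
  using volterra_majorant_mono[OF weight_integrable weight_nonneg] assms by simp

lemma norm_bessel_iter_le:
  assumes "0 < r" "r \<le> 1"
  shows "norm (bessel_iter l V k r) \<le> r powr (l + 1) * majorant k 1"
proof -
  have "norm (bessel_iter l V k r) \<le> r powr (l + 1) * majorant k r"
    using bessel_iter_source_bound assms by (simp add: source_bound_def)
  also have "\<dots> \<le> r powr (l + 1) * majorant k 1"
    using majorant_le[of r k] assms by (intro mult_left_mono) auto
  finally show ?thesis .
qed

text \<open>The value at the origin is defined as a one-sided limit, and the bound by \<open>r\<^sup>l\<^sup>+\<^sup>1\<close> identifies it.\<close>

lemma bessel_iter_at_0: "bessel_iter l V k 0 = 0"
proof -
  have "(bessel_iter_pos l V k \<longlongrightarrow> 0) (at 0 within {0..1})"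
  proof (rule Lim_null_comparison)
    show "((\<lambda>r. r powr (l + 1) * majorant k 1) \<longlongrightarrow> 0) (at 0 within {0..1})"
      using l_pos by (intro tendsto_mult_left_zero powr_tendsto_0_within) simp
    have "norm (bessel_iter_pos l V k r) \<le> r powr (l + 1) * majorant k 1" if "0 < r" "r \<le> 1" for r
      using norm_bessel_iter_le[OF that, of k] that by (simp add: bessel_iter_def)
    then show "\<forall>\<^sub>F r in at 0 within {0..1}. norm (bessel_iter_pos l V k r) \<le> r powr (l + 1) * majorant k 1"
      by (auto simp: eventually_at_filter less_eq_real_def)
  qed
  then have "Lim (at_right 0) (bessel_iter_pos l V k) = 0"
    by (intro tendsto_Lim) (auto simp: at_within_Icc_at_right)
  then show ?thesis by (simp add: bessel_iter_def)
qed

definition iter_deriv :: "nat \<Rightarrow> real \<Rightarrow> complex" where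
  "iter_deriv k = (case k of 0 \<Rightarrow> (\<lambda>r. of_real ((l + 1) * r powr l))
     | Suc j \<Rightarrow> green_deriv (bessel_iter l V j))"

lemma free_has_vector_derivative:
  assumes "0 < r"
  shows "((\<lambda>r. complex_of_real (r powr (l + 1))) has_vector_derivative of_real ((l + 1) * r powr l))
      (at r within S)"
proof (rule has_vector_derivative_of_real)
  have "((\<lambda>r. r powr (l + 1)) has_real_derivative (l + 1) * r powr l) (at r)"
    using assms by (auto intro!: derivative_eq_intros)
  then show "((\<lambda>r. r powr (l + 1)) has_real_derivative (l + 1) * r powr l) (at r within S)"
    by (rule has_field_derivative_at_within)
qed

lemma bessel_iter_has_vector_derivative:
  assumes r: "r \<in> {0..1}"
  shows "(bessel_iter l V k has_vector_derivative iter_deriv k r) (at r within {0..1})"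
proof (cases "r = 0")
  case True
  have "iter_deriv k 0 = 0"
    using l_pos by (cases k) (auto simp: iter_deriv_def green_0)
  moreover have "(bessel_iter l V k has_vector_derivative 0) (at 0 within {0..1})"
    using l_pos bessel_iter_at_0 norm_bessel_iter_le by (rule has_vector_derivative_zero_at_0)
  ultimately show ?thesis using True by simp
next
  case False
  show ?thesis
  proof (cases k)
    case 0
    have "((\<lambda>r. complex_of_real (r powr (l + 1))) has_vector_derivative iter_deriv 0 r) (at r within {0..1})"
      using free_has_vector_derivative[of r] False r by (simp add: iter_deriv_def)
    moreover have "bessel_iter l V 0 s = of_real (s powr (l + 1))" for s
      using bessel_iter_at_0[of 0] by (cases "s = 0") (auto simp: bessel_iter_def)
    ultimately show ?thesis
      using 0 has_vector_derivative_transform[OF r] by metis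
  next
    case (Suc j)
    have "(green (bessel_iter l V j) has_vector_derivative iter_deriv (Suc j) r) (at r within {0..1})"
      using green_has_vector_derivative[OF bessel_iter_source_bound[of j], of r] False r
      by (simp add: iter_deriv_def)
    then show ?thesis unfolding Suc
    proof (rule has_vector_derivative_transform[OF r, rotated])
      show "bessel_iter l V (Suc j) s = green (bessel_iter l V j) s" if "s \<in> {0..1}" for s
        using bessel_iter_Suc[OF bessel_iter_source_bound, of s j] that bessel_iter_at_0[of "Suc j"] green_0(1)
        by (cases "s = 0") auto
    qed
  qed
qed

lemma deriv01_bessel_iter: "r \<in> {0..1} \<Longrightarrow> deriv01 (bessel_iter l V k) r = iter_deriv k r"
  by (rule deriv01_eq[OF bessel_iter_has_vector_derivative])

lemma norm_iter_deriv_le: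
  assumes "r \<in> {0..1}"
  shows "norm (iter_deriv k r) \<le> (l + 1) * majorant k 1"
proof (cases k)
  case 0
  have "norm (iter_deriv 0 r) = (l + 1) * r powr l"
    using l_pos unfolding iter_deriv_def by (simp only: nat.case norm_of_real) simp
  also have "\<dots> \<le> (l + 1) * 1"
    using powr_l_le_1[of r] l_pos assms by (intro mult_left_mono) auto
  finally show ?thesis using 0 by simp
next
  case (Suc j)
  have "norm (iter_deriv k r) \<le> r powr l * majorant k r"
    using norm_green_le(2)[OF bessel_iter_source_bound[of j] assms] Suc by (simp add: iter_deriv_def)
  also have "\<dots> \<le> (l + 1) * majorant k 1"
    using powr_l_le_1[of r] l_pos assms majorant_le[of r k]
      volterra_majorant_nonneg[OF weight_integrable weight_nonneg, of r k]
    by (intro mult_mono) auto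
  finally show ?thesis .
qed

lemma majorant_summable: "summable (\<lambda>k. majorant k 1)"
  using volterra_majorant_summable[OF weight_integrable weight_nonneg] by simp

lemma norm_bessel_iter_le_majorant:
  assumes "r \<in> {0..1}" shows "norm (bessel_iter l V k r) \<le> majorant k 1"
proof (cases "r = 0")
  case False
  have "norm (bessel_iter l V k r) \<le> r powr (l + 1) * majorant k 1"
    using norm_bessel_iter_le False assms by simp
  also have "\<dots> \<le> 1 * majorant k 1"
    using assms l_pos volterra_majorant_nonneg[OF weight_integrable weight_nonneg, of 1 k]
    by (intro mult_right_mono powr_le1) auto
  finally show ?thesis by simp
qed (use volterra_majorant_nonneg[OF weight_integrable weight_nonneg, of 1 k] bessel_iter_at_0 in auto)

lemma series_abs_unif_convergent_on_majorized:
  assumes "\<And>k r. r \<in> S \<Longrightarrow> norm (f k r) \<le> M k" "summable M"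
  shows "series_abs_unif_convergent_on S f"
  unfolding series_abs_unif_convergent_on_def
  using assms by (auto intro!: Weierstrass_m_test'[of S f M] intro: summable_comparison_test')

lemma bessel_iter_series: "series_abs_unif_convergent_on {0..1} (bessel_iter l V)"
  using norm_bessel_iter_le_majorant majorant_summable by (rule series_abs_unif_convergent_on_majorized)

lemma bessel_iter_deriv_series:
  "series_abs_unif_convergent_on {0..1} (\<lambda>k. deriv01 (bessel_iter l V k))"
proof (rule series_abs_unif_convergent_on_majorized)
  show "norm (deriv01 (bessel_iter l V k) r) \<le> (l + 1) * majorant k 1" if "r \<in> {0..1}" for k r
    using norm_iter_deriv_le[OF that] deriv01_bessel_iter[OF that] by simp
qed (intro summable_mult majorant_summable)

section \<open>The regular solution\<close>

definition majorant_sum :: real where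
  "majorant_sum = (\<Sum>k. majorant k 1)"

abbreviation "w \<equiv> bessel_sol l V"

lemma norm_partial_sum_le:
  assumes "0 < r" "r \<le> 1"
  shows "norm (\<Sum>k<n. bessel_iter l V k r) \<le> r powr (l + 1) * majorant_sum"
proof -
  have "norm (\<Sum>k<n. bessel_iter l V k r) \<le> (\<Sum>k<n. r powr (l + 1) * majorant k 1)"
    using norm_bessel_iter_le[OF assms] by (rule sum_norm_le)
  also have "\<dots> \<le> r powr (l + 1) * majorant_sum"
    unfolding sum_distrib_left[symmetric] majorant_sum_def
    using volterra_majorant_nonneg[OF weight_integrable weight_nonneg, of 1]
    by (intro mult_left_mono sum_le_suminf majorant_summable) auto
  finally show ?thesis .
qed

lemma partial_sums_uniform_limit:
  "uniform_limit {0..1} (\<lambda>n r. \<Sum>k<n. bessel_iter l V k r) w sequentially"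
  unfolding bessel_sol_def[abs_def]
  using norm_bessel_iter_le_majorant majorant_summable by (rule Weierstrass_m_test)

lemma partial_sums_tendsto: "r \<in> {0..1} \<Longrightarrow> (\<lambda>n. \<Sum>k<n. bessel_iter l V k r) \<longlonglongrightarrow> w r"
  using tendsto_uniform_limitI[OF partial_sums_uniform_limit] by simp

lemma bessel_iter_continuous: "continuous_on {0..1} (bessel_iter l V k)"
  using has_vector_derivative_continuous[OF bessel_iter_has_vector_derivative]
  by (simp add: continuous_on_eq_continuous_within)

lemma partial_sum_source_bound: "source_bound (\<lambda>r. \<Sum>k<n. bessel_iter l V k r) (\<lambda>r. majorant_sum)"
  unfolding source_bound_def using norm_partial_sum_le
  by (auto intro!: continuous_intros continuous_on_subset[OF bessel_iter_continuous])

lemma bessel_sol_source_bound: "source_bound w (\<lambda>r. majorant_sum)"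
proof -
  have "continuous_on {0..1} w"
    by (rule uniform_limit_theorem[OF _ partial_sums_uniform_limit])
       (auto intro!: always_eventually continuous_intros bessel_iter_continuous)
  moreover have "norm (w r) \<le> r powr (l + 1) * majorant_sum" if "r \<in> {0<..1}" for r
  proof (rule LIMSEQ_le_const2[OF tendsto_norm[OF partial_sums_tendsto]])
    show "\<exists>N. \<forall>n\<ge>N. norm (\<Sum>k<n. bessel_iter l V k r) \<le> r powr (l + 1) * majorant_sum"
      using norm_partial_sum_le that by auto
  qed (use that in auto)
  ultimately show ?thesis
    by (auto simp: source_bound_def intro: continuous_on_subset)
qed

text \<open>The limit of the identity between consecutive partial sums
\<open>S\<^sub>n\<^sub>+\<^sub>1 = \<psi>\<^sub>0 + G S\<^sub>n\<close>.\<close>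

lemma bessel_sol_integral_equation:
  assumes r: "r \<in> {0..1}"
  shows "w r = of_real (r powr (l + 1)) + green w r"
proof (cases "r = 0")
  case True
  then show ?thesis by (simp add: bessel_sol_def bessel_iter_at_0 green_0)
next
  case False
  then have r': "0 < r" "r \<le> 1" using r by auto
  have "(\<lambda>n. \<Sum>k<Suc n. bessel_iter l V k r) \<longlonglongrightarrow> w r"
    using partial_sums_tendsto[OF r] by (rule LIMSEQ_Suc)
  moreover have "(\<Sum>k<Suc n. bessel_iter l V k r)
      = of_real (r powr (l + 1)) + green (\<lambda>s. \<Sum>k<n. bessel_iter l V k s) r" for n
  proof -
    have "bessel_iter l V 0 r = of_real (r powr (l + 1))" using r' by (simp add: bessel_iter_def)
    then show ?thesis
      unfolding sum.lessThan_Suc_shift green_sum[OF bessel_iter_source_bound r]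
      by (simp add: bessel_iter_Suc[OF bessel_iter_source_bound r'])
  qed
  moreover have "(\<lambda>n. of_real (r powr (l + 1)) + green (\<lambda>s. \<Sum>k<n. bessel_iter l V k s) r)
      \<longlonglongrightarrow> of_real (r powr (l + 1)) + green w r"
    by (intro tendsto_intros green_tendsto[OF partial_sum_source_bound _ r] partial_sums_tendsto) auto
  ultimately show ?thesis using LIMSEQ_unique by auto
qed

text \<open>Obtained by differentiating the integral equation, not the series; the convention \<open>0 powr a = 0\<close>
makes the formula give the correct value \<open>0\<close> at the origin.\<close>

definition sol_deriv :: "real \<Rightarrow> complex" where
  "sol_deriv r = of_real ((l + 1) * r powr l) + green_deriv w r"

lemma bessel_sol_has_vector_derivative:
  assumes r: "r \<in> {0..1}"
  shows "(w has_vector_derivative sol_deriv r) (at r within {0..1})"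
proof (cases "r = 0")
  case True
  have "(w has_vector_derivative 0) (at 0 within {0..1})"
  proof (rule has_vector_derivative_zero_at_0[OF l_pos])
    show "w 0 = 0" using bessel_sol_integral_equation[of 0] by (simp add: green_0)
    show "norm (w s) \<le> s powr (l + 1) * majorant_sum" if "0 < s" "s \<le> 1" for s
      using bessel_sol_source_bound that by (simp add: source_bound_def)
  qed
  then show ?thesis using True l_pos by (simp add: sol_deriv_def green_0)
next
  case False
  have "((\<lambda>r. of_real (r powr (l + 1)) + green w r) has_vector_derivative sol_deriv r) (at r within {0..1})"
    unfolding sol_deriv_def using False r
    by (intro has_vector_derivative_add free_has_vector_derivative
        green_has_vector_derivative[OF bessel_sol_source_bound]) auto
  then show ?thesis
    by (rule has_vector_derivative_transform[OF r, rotated]) (rule bessel_sol_integral_equation)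
qed

lemma deriv01_bessel_sol: "r \<in> {0..1} \<Longrightarrow> deriv01 w r = sol_deriv r"
  by (rule deriv01_eq[OF bessel_sol_has_vector_derivative])

text \<open>The relative size of \<open>G w\<close> compared with the free solution, on \<open>(0,r)\<close>.\<close>

definition perturbation_bound :: "real \<Rightarrow> real" where
  "perturbation_bound r = integral {0..r} (\<lambda>s. weight s * majorant_sum)"

lemma perturbation_bound_tendsto_0: "(perturbation_bound \<longlongrightarrow> 0) (at 0 within {0..1})"
proof -
  have "continuous_on {0..1} perturbation_bound"
    unfolding perturbation_bound_def[abs_def]
    by (intro indefinite_integral_continuous_1 weight_mult_integrable) auto
  then have "(perturbation_bound \<longlongrightarrow> perturbation_bound 0) (at 0 within {0..1})"
    by (simp add: continuous_on_def)
  then show ?thesis by (simp add: perturbation_bound_def)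
qed

lemma bessel_sol_asymp:
  "w \<sim>[at_right 0] (\<lambda>r. of_real (r powr (l + 1)))"
  "deriv01 w \<sim>[at_right 0] (\<lambda>r. of_real ((l + 1) * r powr l))"
proof -
  show "w \<sim>[at_right 0] (\<lambda>r. of_real (r powr (l + 1)))"
  proof (rule asymp_equiv_at_right_0_of_bound[OF _ _ perturbation_bound_tendsto_0])
    show "norm (w r - of_real (r powr (l + 1))) \<le> r powr (l + 1) * perturbation_bound r" if "0 < r" "r \<le> 1" for r
      using norm_green_le(1)[OF bessel_sol_source_bound, of r] bessel_sol_integral_equation[of r] that
      by (simp add: perturbation_bound_def)
  qed simp
  show "deriv01 w \<sim>[at_right 0] (\<lambda>r. of_real ((l + 1) * r powr l))"
  proof (rule asymp_equiv_at_right_0_of_bound[OF _ _ perturbation_bound_tendsto_0])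
    fix r :: real assume r: "0 < r" "r \<le> 1"
    have le: "norm (green_deriv w r) \<le> r powr l * perturbation_bound r"
      using norm_green_le(2)[OF bessel_sol_source_bound, of r] r by (simp add: perturbation_bound_def)
    moreover have "0 \<le> perturbation_bound r"
      using le norm_ge_zero[of "green_deriv w r"] r by (smt (verit) mult_pos_neg powr_gt_zero)
    ultimately have "norm (green_deriv w r) \<le> (l + 1) * r powr l * perturbation_bound r"
      using l_pos by (simp add: algebra_simps add_increasing2)
    then show "norm (deriv01 w r - of_real ((l + 1) * r powr l)) \<le> (l + 1) * r powr l * perturbation_bound r"
      using r by (simp add: deriv01_bessel_sol sol_deriv_def)
  qed (use l_pos in simp)
qed

lemma bessel_sol_C1: "C1_on_interval 0 1 w"
  unfolding C1_on_interval_def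
proof (intro exI[of _ sol_deriv] conjI ballI bessel_sol_has_vector_derivative)
  have "continuous (at r within {0..1}) sol_deriv" if r: "r \<in> {0..1}" for r
  proof (cases "r = 0")
    case True
    have z: "sol_deriv 0 = 0" using l_pos by (simp add: sol_deriv_def green_0)
    have "((\<lambda>r. of_real ((l + 1) * r powr l) + green_deriv w r) \<longlongrightarrow> of_real ((l + 1) * 0) + 0)
        (at 0 within {0..1})"
    proof (intro tendsto_intros powr_tendsto_0_within l_pos)
      show "(green_deriv w \<longlongrightarrow> 0) (at 0 within {0..1})"
      proof (rule Lim_null_comparison)
        show "((\<lambda>r. r powr l * perturbation_bound r) \<longlongrightarrow> 0) (at 0 within {0..1})"
          using tendsto_mult[OF powr_tendsto_0_within[OF l_pos] perturbation_bound_tendsto_0] by simp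
        show "\<forall>\<^sub>F r in at 0 within {0..1}. norm (green_deriv w r) \<le> r powr l * perturbation_bound r"
          using norm_green_le(2)[OF bessel_sol_source_bound]
          by (auto simp: eventually_at_filter perturbation_bound_def)
      qed
    qed
    then show ?thesis
      using True z by (simp add: continuous_within sol_deriv_def[abs_def])
  next
    case False
    have "continuous_on {0<..1} sol_deriv"
      unfolding sol_deriv_def[abs_def]
      by (intro continuous_intros green_deriv_continuous[OF bessel_sol_source_bound]) auto
    then have "continuous (at r within {0<..1}) sol_deriv"
      using r False by (simp add: continuous_on_eq_continuous_within)
    moreover have "at r within {0<..1} = at r within {0..1}"
      using r False by (intro at_within_nhd[of _ "{0<..}"]) auto
    ultimately show ?thesis by simp
  qed
  then show "continuous_on {0..1} sol_deriv" by (simp add: continuous_on_eq_continuous_within)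
qed

lemma sol_deriv_expansion:
  "sol_deriv r = ((l + 1) * r powr l) *\<^sub>R 1 +
     ((((l + 1) / (2 * l + 1)) * r powr l) *\<^sub>R regular_coeff w r +
      ((l / (2 * l + 1)) * r powr (- l - 1)) *\<^sub>R singular_coeff w r)"
  by (simp add: sol_deriv_def green_deriv_def scaleR_conv_of_real algebra_simps add_divide_distrib)

text \<open>Only the powers of \<open>r\<close> restrict this to intervals that stay away from the origin: the coefficients
themselves are absolutely continuous on all of \<open>[0,1]\<close>.\<close>

lemma bessel_sol_deriv_AC:
  assumes \<delta>: "0 < \<delta>" "\<delta> < 1"
  shows "AC_on_interval \<delta> 1 (deriv01 w)"
proof -
  note sb = bessel_sol_source_bound
  have A: "AC_on_interval \<delta> 1 (regular_coeff w)"
    unfolding regular_coeff_def[abs_def]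
    by (rule AC_on_interval_subset[OF AC_on_interval_integral[OF regular_source_integrable[OF sb]]])
       (use \<delta> in auto)
  have B: "AC_on_interval \<delta> 1 (singular_coeff w)"
    unfolding singular_coeff_def[abs_def]
    by (rule AC_on_interval_subset[OF AC_on_interval_integral[OF singular_source_integrable[OF sb]]])
       (use \<delta> in auto)
  have Ac: "continuous_on {\<delta>..1} (regular_coeff w)" and Bc: "continuous_on {\<delta>..1} (singular_coeff w)"
    using \<delta> by (auto intro: continuous_on_subset[OF coeff_continuous(1)[OF sb]]
        continuous_on_subset[OF coeff_continuous(2)[OF sb]])
  have powr_deriv: "((\<lambda>r. c * r powr a) has_real_derivative c * (a * x powr (a - 1))) (at x)"
    if "x \<in> {\<delta>..1}" for a c x :: real
    using that \<delta> by (auto intro!: derivative_eq_intros)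
  have powr_cont: "continuous_on {\<delta>..1} (\<lambda>x. c * (a * x powr (a - 1)))" for a c :: real
    using \<delta> by (intro continuous_intros) auto
  have scale: "AC_on_interval \<delta> 1 (\<lambda>r. (c * r powr a) *\<^sub>R F r)"
    if "AC_on_interval \<delta> 1 F" "continuous_on {\<delta>..1} F" for c a F
    by (rule AC_on_interval_scaleR[OF that powr_deriv powr_cont])
  have "AC_on_interval \<delta> 1 sol_deriv"
    unfolding sol_deriv_expansion[abs_def]
    by (intro AC_on_interval_add scale AC_on_interval_const A B Ac Bc continuous_on_const)
  then show ?thesis
    by (rule AC_on_interval_cong) (use \<delta> in \<open>auto simp: deriv01_bessel_sol\<close>)
qed

text \<open>Differentiating \<open>w'\<close> once more, the powers of \<open>r\<close> reproduce \<open>l (l + 1) / r\<^sup>2\<close> times \<open>w\<close>, because both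
free solutions satisfy the unperturbed equation, and the derivatives of the coefficients add up to
the source \<open>V w\<close>, because the Wronskian of the free solutions is \<open>2 l + 1\<close>.\<close>

lemma bessel_equation_ae:
  "AE r\<in>{0<..<1} in lebesgue. \<exists>w''. (deriv01 w has_vector_derivative w'') (at r) \<and>
     - w'' + of_real (l * (l + 1) / r\<^sup>2) * w r + V r * w r = 0"
proof -
  note sb = bessel_sol_source_bound
  obtain N1 where N1: "negligible N1" "\<And>r. r \<in> {0<..<1} - N1 \<Longrightarrow>
      (regular_coeff w has_vector_derivative (r powr - l) *\<^sub>R (V r * w r)) (at r)"
    using indefinite_integral_has_vector_derivative_ae[OF source_integrable_on(1)[OF sb]]
    unfolding regular_coeff_def[abs_def] by blast
  obtain N2 where N2: "negligible N2" "\<And>r. r \<in> {0<..<1} - N2 \<Longrightarrow>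
      (singular_coeff w has_vector_derivative (r powr (l + 1)) *\<^sub>R (V r * w r)) (at r)"
    using indefinite_integral_has_vector_derivative_ae[OF source_integrable_on(2)[OF sb]]
    unfolding singular_coeff_def[abs_def] by blast
  have eqn: "\<exists>w''. (deriv01 w has_vector_derivative w'') (at r) \<and>
     - w'' + of_real (l * (l + 1) / r\<^sup>2) * w r + V r * w r = 0"
    if r: "r \<in> {0<..<1} - (N1 \<union> N2)" for r
  proof -
    define P Q where "P = r powr (l + 1)" and "Q = r powr - l"
    define A B where "A = regular_coeff w r" and "B = singular_coeff w r"
    define c where "c = 1 / (2 * l + 1)"
    define D where "D = ((l + 1) * (l * r powr (l - 1))) *\<^sub>R 1 +
      ((((l + 1) / (2 * l + 1)) * r powr l) *\<^sub>R (Q *\<^sub>R (V r * w r)) +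
        ((l + 1) / (2 * l + 1) * (l * r powr (l - 1))) *\<^sub>R A +
       (((l / (2 * l + 1)) * r powr (- l - 1)) *\<^sub>R (P *\<^sub>R (V r * w r)) +
        (l / (2 * l + 1) * ((- l - 1) * r powr (- l - 1 - 1))) *\<^sub>R B))"
    have r0: "0 < r" "r < 1" using r by auto
    have powr_deriv: "((\<lambda>r. c * r powr a) has_real_derivative c * (a * r powr (a - 1))) (at r)" for a c :: real
      using r0 by (auto intro!: derivative_eq_intros)
    have "(sol_deriv has_vector_derivative
      ((l + 1) * r powr l) *\<^sub>R 0 + ((l + 1) * (l * r powr (l - 1))) *\<^sub>R 1 +
      ((((l + 1) / (2 * l + 1)) * r powr l) *\<^sub>R (Q *\<^sub>R (V r * w r)) +
        ((l + 1) / (2 * l + 1) * (l * r powr (l - 1))) *\<^sub>R A +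
       (((l / (2 * l + 1)) * r powr (- l - 1)) *\<^sub>R (P *\<^sub>R (V r * w r)) +
        (l / (2 * l + 1) * ((- l - 1) * r powr (- l - 1 - 1))) *\<^sub>R B))) (at r)"
      unfolding sol_deriv_expansion[abs_def] A_def B_def P_def Q_def
      by (intro has_vector_derivative_add has_vector_derivative_scaleR powr_deriv
          has_vector_derivative_const N1(2) N2(2)) (use r in auto)
    then have "(sol_deriv has_vector_derivative D) (at r)"
      by (simp add: D_def)
    then have deriv: "(deriv01 w has_vector_derivative D) (at r)"
      by (rule has_vector_derivative_transform_within_open[of _ _ _ "{0<..<1}"])
         (use r0 in \<open>auto simp: deriv01_bessel_sol\<close>)
    have "r powr 2 = r\<^sup>2" using r0 powr_numeral[of r] by simp
    then have e1: "r powr (l - 1) = P / r\<^sup>2" and e2: "r powr (- l - 1 - 1) = Q / r\<^sup>2"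
      using powr_diff[of r "l + 1" 2] powr_diff[of r "- l" 2] by (simp_all add: P_def Q_def algebra_simps)
    have e3: "r powr l * Q = 1" and e4: "r powr (- l - 1) * P = 1"
      using r0 by (simp_all add: P_def Q_def powr_add[symmetric])
    have w: "w r = of_real P + of_real c * (of_real P * A - of_real Q * B)"
      using bessel_sol_integral_equation[of r] r0
      by (simp add: green_def A_def B_def P_def Q_def c_def scaleR_conv_of_real)
    have c1: "(l + 1) / (2 * l + 1) = (l + 1) * c" "l / (2 * l + 1) = l * c" "(l + 1) * c + l * c = 1"
      using l_pos by (auto simp: c_def add_divide_distrib[symmetric])
    have "D = of_real (l * (l + 1) / r\<^sup>2) * (of_real P + of_real c * (of_real P * A - of_real Q * B))
        + of_real ((l + 1) * c * (r powr l * Q) + l * c * (r powr (- l - 1) * P)) * (V r * w r)"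
      unfolding D_def e1 e2 c1(1,2) by (simp add: scaleR_conv_of_real algebra_simps divide_inverse)
    also have "\<dots> = of_real (l * (l + 1) / r\<^sup>2) * w r + V r * w r"
      unfolding e3 e4 mult_1_right c1(3) w[symmetric] by simp
    finally show ?thesis using deriv by (intro exI[of _ D]) simp
  qed
  have "N1 \<union> N2 \<in> null_sets lebesgue"
    using N1(1) N2(1) by (simp add: negligible_iff_null_sets[symmetric])
  then show ?thesis by (rule AE_I') (use eqn in blast)
qed

end

theorem proposition7:
  fixes l :: real and V :: "real \<Rightarrow> complex"
  assumes l_pos: "l > 0"
    and V_meas: "V \<in> borel_measurable (lebesgue_on {0<..<1})"
    and V_int: "set_integrable lebesgue {0<..<1} (\<lambda>r. r * norm (V r))"
  shows "(\<forall>k. \<forall>r\<in>{0<..1}. set_integrable lebesgue {0<..<r}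
            (\<lambda>s. of_real (bessel_kernel l r s) * V s * bessel_iter l V k s))
    \<and> series_abs_unif_convergent_on {0..1} (bessel_iter l V)
    \<and> (\<forall>k. bessel_iter l V k differentiable_on {0..1})
    \<and> series_abs_unif_convergent_on {0..1} (\<lambda>k. deriv01 (bessel_iter l V k))
    \<and> C1_on_interval 0 1 (bessel_sol l V)
    \<and> (\<forall>\<delta>. 0 < \<delta> \<and> \<delta> < 1 \<longrightarrow> AC_on_interval \<delta> 1 (deriv01 (bessel_sol l V)))
    \<and> (AE r\<in>{0<..<1} in lebesgue. \<exists>w''.
          (deriv01 (bessel_sol l V) has_vector_derivative w'') (at r) \<and>
          - w'' + of_real (l * (l + 1) / r\<^sup>2) * bessel_sol l V r + V r * bessel_sol l V r = 0)
    \<and> bessel_sol l V \<sim>[at_right 0] (\<lambda>r. of_real (r powr (l + 1)))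
    \<and> deriv01 (bessel_sol l V) \<sim>[at_right 0] (\<lambda>r. of_real ((l + 1) * r powr l))"
proof -
  interpret bessel_potential l V
    using assms by unfold_locales
  have "bessel_iter l V k differentiable_on {0..1}" for k
    unfolding differentiable_on_def
    using bessel_iter_has_vector_derivative differentiableI_vector by blast
  then show ?thesis
    using green_kernel(1)[OF bessel_iter_source_bound] bessel_iter_series bessel_iter_deriv_series
      bessel_sol_C1 bessel_sol_deriv_AC bessel_equation_ae bessel_sol_asymp
    by auto
qed

end
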